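(* Let $\mathfrak e_3$ be the subalgebra $\left\{\begin{pmatrix}A&B\\0&A\end{pmatrix}\ \middle|\ A,B\in\mathfrak{sl}_2(\mathbb C)\right\}$ of $\mathfrak{sl}_4(\mathbb C)$. The simple finite-dimensional $\mathfrak{sl}_4$-module with highest weight $\lambda$ is $\mathfrak e_3$-indecomposable if and only if $\lambda=m\varphi_1$ or $\lambda=m\varphi_3$ for some integer $m\ge0$.
   Context: $\varphi_1,\varphi_2,\varphi_3$ are the fundamental weights of $\mathfrak{sl}_4$ in the usual numbering along the Dynkin diagram (so $\varphi_1$ and $\varphi_3$ are the highest weights of $\mathbb C^4$ and its dual, $\varphi_2$ that of $\bigwedge^2\mathbb C^4$). A module is $\mathfrak e_3$-indecomposable if it cannot be written as a direct sum of two proper $\mathfrak e_3$-submodules. *)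

theory Defs
  imports Complex_Main "Jordan_Normal_Form.Matrix"
begin

section \<open>The Lie algebras\<close>

definition sl :: "nat \<Rightarrow> complex mat set" where
  "sl n = {X \<in> carrier_mat n n. (\<Sum>i<n. X $$ (i, i)) = 0}"

definition lie_bracket :: "complex mat \<Rightarrow> complex mat \<Rightarrow> complex mat" where
  "lie_bracket X Y = X * Y - Y * X"

text \<open>Linear subspaces of the \<open>n \<times> n\<close> matrices that are closed under the bracket.\<close>

definition matrix_lie_algebra :: "nat \<Rightarrow> complex mat set \<Rightarrow> bool" where
  "matrix_lie_algebra n L \<longleftrightarrow>
     L \<subseteq> carrier_mat n n \<and> 0\<^sub>m n n \<in> L \<and>
     (\<forall>X\<in>L. \<forall>Y\<in>L. X + Y \<in> L) \<and>
     (\<forall>c. \<forall>X\<in>L. c \<cdot>\<^sub>m X \<in> L) \<and>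
     (\<forall>X\<in>L. \<forall>Y\<in>L. lie_bracket X Y \<in> L)"

definition e3 :: "complex mat set" where
  "e3 = {four_block_mat A B (0\<^sub>m 2 2) A | A B. A \<in> sl 2 \<and> B \<in> sl 2}"

text \<open>The standard Cartan and nilpotent subalgebras of \<^term>\<open>sl n\<close>; the positive root spaces
  are the ones above the diagonal.\<close>

definition cartan :: "nat \<Rightarrow> complex mat set" where
  "cartan n = {H \<in> sl n. diagonal_mat H}"

definition strictly_upper :: "nat \<Rightarrow> complex mat set" where
  "strictly_upper n = {N \<in> carrier_mat n n. \<forall>i<n. \<forall>j\<le>i. N $$ (i, j) = 0}"

text \<open>The fundamental weight \<open>\<phi>\<^sub>i\<close> (\<open>1 \<le> i < n\<close>) is dual to the coroots
  \<open>E\<^sub>k\<^sub>k - E\<^bsub>k+1,k+1\<^esub>\<close>, hence is the sum of the first \<open>i\<close> diagonal entries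
  (see \<open>fund_weight_coroot\<close> below). Matrix indices start at \<open>0\<close>. Only the values on
  \<^term>\<open>cartan n\<close> are meaningful.\<close>

definition fund_weight :: "nat \<Rightarrow> complex mat \<Rightarrow> complex" where
  "fund_weight i H = (\<Sum>k<i. H $$ (k, k))"

definition coroot :: "nat \<Rightarrow> nat \<Rightarrow> complex mat" where
  "coroot n k = mat n n (\<lambda>(i, j). if i = j then (if Suc i = k then 1 else if i = k then -1 else 0) else 0)"


section \<open>Modules\<close>

text \<open>A module is a complex vector space, whose carrier is a whole type, together with an action
  \<open>\<rho>\<close> of which only the restriction to \<open>L\<close> matters.\<close>

locale lie_module = vector_space scale
  for scale :: "complex \<Rightarrow> 'v::ab_group_add \<Rightarrow> 'v" +
  fixes L :: "complex mat set" and \<rho> :: "complex mat \<Rightarrow> 'v \<Rightarrow> 'v"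
  assumes act_linear: "X \<in> L \<Longrightarrow> Vector_Spaces.linear scale scale (\<rho> X)"
    and act_add: "X \<in> L \<Longrightarrow> Y \<in> L \<Longrightarrow> \<rho> (X + Y) v = \<rho> X v + \<rho> Y v"
    and act_smult: "X \<in> L \<Longrightarrow> \<rho> (c \<cdot>\<^sub>m X) v = scale c (\<rho> X v)"
    and act_bracket: "X \<in> L \<Longrightarrow> Y \<in> L \<Longrightarrow> \<rho> (lie_bracket X Y) v = \<rho> X (\<rho> Y v) - \<rho> Y (\<rho> X v)"

definition lie_submodule ::
  "(complex \<Rightarrow> 'v::ab_group_add \<Rightarrow> 'v) \<Rightarrow> complex mat set \<Rightarrow> (complex mat \<Rightarrow> 'v \<Rightarrow> 'v) \<Rightarrow> 'v set \<Rightarrow> bool" where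
  "lie_submodule scale L \<rho> W \<longleftrightarrow>
     module.subspace scale W \<and> (\<forall>X\<in>L. \<forall>w\<in>W. \<rho> X w \<in> W)"

definition simple_module ::
  "(complex \<Rightarrow> 'v::ab_group_add \<Rightarrow> 'v) \<Rightarrow> complex mat set \<Rightarrow> (complex mat \<Rightarrow> 'v \<Rightarrow> 'v) \<Rightarrow> bool" where
  "simple_module scale L \<rho> \<longleftrightarrow>
     (UNIV :: 'v set) \<noteq> {0} \<and>
     (\<forall>W. lie_submodule scale L \<rho> W \<longrightarrow> W = {0} \<or> W = UNIV)"

definition indecomposable ::
  "(complex \<Rightarrow> 'v::ab_group_add \<Rightarrow> 'v) \<Rightarrow> complex mat set \<Rightarrow> (complex mat \<Rightarrow> 'v \<Rightarrow> 'v) \<Rightarrow> bool" where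
  "indecomposable scale L \<rho> \<longleftrightarrow>
     \<not> (\<exists>U W. lie_submodule scale L \<rho> U \<and> lie_submodule scale L \<rho> W \<and>
           U \<noteq> UNIV \<and> W \<noteq> UNIV \<and>
           U \<inter> W = {0} \<and> {u + w | u w. u \<in> U \<and> w \<in> W} = UNIV)"

definition has_highest_weight ::
  "(complex \<Rightarrow> 'v::ab_group_add \<Rightarrow> 'v) \<Rightarrow> nat \<Rightarrow> (complex mat \<Rightarrow> 'v \<Rightarrow> 'v) \<Rightarrow> (complex mat \<Rightarrow> complex) \<Rightarrow> bool" where
  "has_highest_weight scale n \<rho> \<mu> \<longleftrightarrow>
     (\<exists>v. v \<noteq> 0 \<and>
          (\<forall>H\<in>cartan n. \<rho> H v = scale (\<mu> H) v) \<and>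
          (\<forall>N\<in>strictly_upper n. \<rho> N v = 0) \<and>
          (\<forall>W. lie_submodule scale (sl n) \<rho> W \<and> v \<in> W \<longrightarrow> W = UNIV))"


section \<open>Consistency checks\<close>

lemma sl_2_trace: "A \<in> sl 2 \<longleftrightarrow> A \<in> carrier_mat 2 2 \<and> A $$ (0, 0) + A $$ (1, 1) = 0"
  by (auto simp: sl_def numeral_2_eq_2)

lemma trace_commute:
  fixes X Y :: "complex mat"
  assumes "X \<in> carrier_mat n n" "Y \<in> carrier_mat n n"
  shows "(\<Sum>i<n. (X * Y) $$ (i, i)) = (\<Sum>i<n. (Y * X) $$ (i, i))"
proof -
  have "(\<Sum>i<n. (X * Y) $$ (i, i)) = (\<Sum>i<n. \<Sum>j<n. X $$ (i, j) * Y $$ (j, i))"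
    using assms by (intro sum.cong refl) (auto simp: scalar_prod_def atLeast0LessThan)
  also have "\<dots> = (\<Sum>j<n. \<Sum>i<n. Y $$ (j, i) * X $$ (i, j))"
    by (subst sum.swap) (simp add: mult.commute)
  also have "\<dots> = (\<Sum>i<n. (Y * X) $$ (i, i))"
    using assms by (intro sum.cong refl) (auto simp: scalar_prod_def atLeast0LessThan)
  finally show ?thesis .
qed

lemma matrix_lie_algebra_sl: "matrix_lie_algebra n (sl n)"
proof -
  have "lie_bracket X Y \<in> sl n" if "X \<in> sl n" "Y \<in> sl n" for X Y
  proof -
    have c: "X \<in> carrier_mat n n" "Y \<in> carrier_mat n n" using that by (auto simp: sl_def)
    have "(\<Sum>i<n. (X * Y - Y * X) $$ (i, i)) = (\<Sum>i<n. (X * Y) $$ (i, i) - (Y * X) $$ (i, i))"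
      using c by (intro sum.cong refl) auto
    also have "\<dots> = 0" using trace_commute[OF c] by (simp add: sum_subtractf)
    finally show ?thesis using c by (auto simp: sl_def lie_bracket_def)
  qed
  then show ?thesis
    by (auto simp: matrix_lie_algebra_def sl_def sum.distrib simp flip: sum_distrib_left)
qed

lemma e3_subset_sl: "e3 \<subseteq> sl 4"
proof
  fix X assume "X \<in> e3"
  then obtain A B where X: "X = four_block_mat A B (0\<^sub>m 2 2) A" and A: "A \<in> sl 2" and B: "B \<in> sl 2"
    by (auto simp: e3_def)
  have c: "A \<in> carrier_mat 2 2" "B \<in> carrier_mat 2 2" using A B by (auto simp: sl_def)
  have "X \<in> carrier_mat (2 + 2) (2 + 2)" unfolding X using c by (intro four_block_carrier_mat)
  moreover have "(\<Sum>i<4. X $$ (i, i)) = 2 * (A $$ (0, 0) + A $$ (1, 1))"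
    unfolding X using c by (simp add: eval_nat_numeral)
  moreover have "A $$ (0, 0) + A $$ (1, 1) = 0" using A by (simp only: sl_2_trace)
  ultimately show "X \<in> sl 4" by (simp only: sl_def) simp
qed

lemma matrix_lie_algebra_e3: "matrix_lie_algebra 4 e3"
proof -
  let ?F = "\<lambda>A B. four_block_mat A B (0\<^sub>m 2 2) A :: complex mat"
  have L: "matrix_lie_algebra 2 (sl 2)" by (rule matrix_lie_algebra_sl)
  have c: "A \<in> carrier_mat 2 2" if "A \<in> sl 2" for A using that by (auto simp: sl_def)
  have I: "?F A B \<in> e3" if "A \<in> sl 2" "B \<in> sl 2" for A B using that by (auto simp: e3_def)
  have zero: "0\<^sub>m 4 4 \<in> e3"
  proof -
    have "(0\<^sub>m 4 4 :: complex mat) = ?F (0\<^sub>m 2 2) (0\<^sub>m 2 2)" by (rule eq_matI) auto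
    moreover have "(0\<^sub>m 2 2 :: complex mat) \<in> sl 2" using L by (simp add: matrix_lie_algebra_def)
    ultimately show ?thesis using I by metis
  qed
  have add: "?F A B + ?F A' B' \<in> e3" if "A \<in> sl 2" "B \<in> sl 2" "A' \<in> sl 2" "B' \<in> sl 2" for A B A' B'
  proof -
    have "?F A B + ?F A' B' = ?F (A + A') (B + B')"
      using that[THEN c] by (intro eq_matI) auto
    then show ?thesis using that I L by (simp add: matrix_lie_algebra_def)
  qed
  have smult: "k \<cdot>\<^sub>m ?F A B \<in> e3" if "A \<in> sl 2" "B \<in> sl 2" for k A B
  proof -
    have "k \<cdot>\<^sub>m ?F A B = ?F (k \<cdot>\<^sub>m A) (k \<cdot>\<^sub>m B)"
      using that[THEN c] by (intro eq_matI) auto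
    then show ?thesis using that I L by (simp add: matrix_lie_algebra_def)
  qed
  have br: "lie_bracket (?F A B) (?F A' B') \<in> e3"
    if "A \<in> sl 2" "B \<in> sl 2" "A' \<in> sl 2" "B' \<in> sl 2" for A B A' B'
  proof -
    have m: "?F A B * ?F A' B' = ?F (A * A') (A * B' + B * A')"
      if "A \<in> carrier_mat 2 2" "B \<in> carrier_mat 2 2" "A' \<in> carrier_mat 2 2" "B' \<in> carrier_mat 2 2"
      for A B A' B'
      using that by (subst mult_four_block_mat[where ?n1.0 = 2 and ?n2.0 = 2 and ?nr1.0 = 2
            and ?nr2.0 = 2 and ?nc1.0 = 2 and ?nc2.0 = 2]) auto
    have "lie_bracket (?F A B) (?F A' B') = ?F (lie_bracket A A') (lie_bracket A B' + lie_bracket B A')"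
      unfolding lie_bracket_def using that[THEN c] by (subst (1 2) m) (auto intro!: eq_matI)
    then show ?thesis using that I L by (simp add: matrix_lie_algebra_def)
  qed
  have "e3 \<subseteq> carrier_mat 4 4" using e3_subset_sl by (auto simp: sl_def)
  then show ?thesis using zero add smult br
    unfolding matrix_lie_algebra_def by (auto simp: e3_def)
qed

lemma coroot_cartan: "0 < k \<Longrightarrow> k < n \<Longrightarrow> coroot n k \<in> cartan n"
proof -
  assume k: "0 < k" "k < n"
  have "(\<Sum>i<n. coroot n k $$ (i, i)) = (\<Sum>i<n. (if i = k - 1 then 1 else 0) + (if i = k then -1 else 0))"
    using k by (intro sum.cong refl) (auto simp: coroot_def)
  also have "\<dots> = 0" using k by (simp add: sum.distrib)
  finally show ?thesis by (auto simp: cartan_def sl_def diagonal_mat_def) (auto simp: coroot_def)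
qed

lemma fund_weight_coroot:
  assumes "0 < i" "i < n" "0 < k" "k < n"
  shows "fund_weight i (coroot n k) = (if i = k then 1 else 0)"
proof -
  have "fund_weight i (coroot n k) = (\<Sum>j<i. (if j = k - 1 then 1 else 0) + (if j = k then -1 else 0))"
    unfolding fund_weight_def using assms by (intro sum.cong refl) (auto simp: coroot_def)
  also have "\<dots> = (if i = k then 1 else 0)" using assms by (auto simp: sum.distrib)
  finally show ?thesis .
qed

lemma lie_module_restrict:
  "lie_module scale L \<rho> \<Longrightarrow> M \<subseteq> L \<Longrightarrow> lie_module scale M \<rho>"
  unfolding lie_module_def lie_module_axioms_def by blast

end

theory Submission
  imports Defs
begin

text \<open>The algebra \<open>e3\<close> lies in the symplectic algebra \<open>sp 4\<close> of fixed points of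
  \<open>X \<mapsto> - S X' S\<close>, where \<open>X'\<close> is the transpose about the antidiagonal and
  \<open>S = diag(1, -1, 1, -1)\<close>. So the Casimir operator of \<open>sp 4\<close> commutes with \<open>e3\<close>. If
  \<open>\<lambda>\<close> is not a multiple of \<open>\<phi>\<^sub>1\<close> or \<open>\<phi>\<^sub>3\<close>, it has two different
  eigenvalues, on the highest weight vector and on an explicit second \<open>sp 4\<close>-singular vector, and the
  Fitting decomposition of a shift of it splits the module.

  In the module with highest weight \<open>m \<phi>\<^sub>1\<close>, that is, in the polynomials of degree \<open>m\<close>, the
  matrix unit \<open>e i j\<close> acts as \<open>x\<^sub>i \<partial>\<^sub>j\<close>. The relation
  \<open>e i 0 (e 0 j x) = (e 0 0 + 1) (e i j x)\<close> for \<open>i, j > 0\<close> and the injectivity of \<open>e 0 0 + 1\<close> show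
  that a nilpotent subalgebra of \<open>e3\<close> kills only the multiples of the highest weight vector \<open>v\<close>. Hence
  \<open>v\<close> lies in every nonzero \<open>e3\<close>-submodule. The case \<open>m \<phi>\<^sub>3\<close> reduces to this one by the
  automorphism above.\<close>

section \<open>Linear algebra\<close>

context vector_space
begin

lemma linearI:
  assumes "\<And>x y. T (x + y) = T x + T y" "\<And>c x. T (scale c x) = scale c (T x)"
  shows "Vector_Spaces.linear scale scale T"
  using assms by unfold_locales auto

lemma linear_minus_scale:
  assumes "Vector_Spaces.linear scale scale T"
  shows "Vector_Spaces.linear scale scale (\<lambda>x. T x - scale c x)"
proof -
  interpret T: Vector_Spaces.linear scale scale T by fact
  show ?thesis
    by (intro linearI) (simp_all add: T.add T.scale scale_right_distrib scale_right_diff_distrib scale_left_commute)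
qed

lemma linear_funpow:
  assumes "Vector_Spaces.linear scale scale T"
  shows "Vector_Spaces.linear scale scale (T ^^ k)"
proof -
  interpret T: Vector_Spaces.linear scale scale T by fact
  have "(T ^^ k) (x + y) = (T ^^ k) x + (T ^^ k) y" "(T ^^ k) (scale c x) = scale c ((T ^^ k) x)" for c x y
    by (induction k) (simp_all add: T.add T.scale)
  then show ?thesis by (rule linearI)
qed

text \<open>The fold applies the product of the operators \<open>T - c\<close>, with
  \<open>c\<close> from \<open>cs\<close>; this lemma and the next give its linearity.\<close>

lemma foldr_minus_scale_add:
  assumes "Vector_Spaces.linear scale scale T"
  shows "foldr (\<lambda>c y. T y - scale c y) cs (x + y) =
    foldr (\<lambda>c y. T y - scale c y) cs x + foldr (\<lambda>c y. T y - scale c y) cs y"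
proof -
  interpret T: Vector_Spaces.linear scale scale T by fact
  show ?thesis by (induction cs) (simp_all add: T.add algebra_simps)
qed

lemma foldr_minus_scale_scale:
  assumes "Vector_Spaces.linear scale scale T"
  shows "foldr (\<lambda>c y. T y - scale c y) cs (scale a x) = scale a (foldr (\<lambda>c y. T y - scale c y) cs x)"
proof -
  interpret T: Vector_Spaces.linear scale scale T by fact
  show ?thesis
    by (induction cs) (simp_all add: T.scale scale_left_commute scale_right_diff_distrib)
qed

lemma foldr_minus_scale_eigen:
  assumes "Vector_Spaces.linear scale scale T" "T x = scale t x"
  shows "foldr (\<lambda>c y. T y - scale c y) cs x = scale (\<Prod>c\<leftarrow>cs. t - c) x"
proof -
  interpret T: Vector_Spaces.linear scale scale T by fact
  show ?thesis
    by (induction cs) (simp_all add: T.scale assms(2) scale_left_diff_distrib left_diff_distrib ac_simps)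
qed

text \<open>Eigenvectors for distinct eigenvalues are independent: a product of factors
  \<open>T - c\<close> with all \<open>c \<noteq> t\<close> kills a given element of the span, but
  multiplies \<open>v\<close> by the nonzero product of the \<open>t - c\<close>.\<close>

lemma eigenvector_in_span_others:
  assumes T: "Vector_Spaces.linear scale scale T" and v: "T v = scale t v"
    and span: "v \<in> span {u. \<exists>c. c \<noteq> t \<and> T u = scale c u}"
  shows "v = 0"
proof -
  let ?p = "foldr (\<lambda>c y. T y - scale c y)"
  have "\<exists>cs. t \<notin> set cs \<and> ?p cs v = 0"
    using span
  proof (induction rule: span_induct_alt)
    case base
    show ?case by (rule exI[of _ "[]"]) simp
  next
    case (step a x y)
    then obtain c cs where c: "c \<noteq> t" "T x = scale c x" and cs: "t \<notin> set cs" "?p cs y = 0"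
      by blast
    interpret T: Vector_Spaces.linear scale scale T by (rule T)
    \<comment> \<open>The outermost factor \<open>T - c\<close> kills \<open>x\<close>; the inner
      ones already kill \<open>y\<close>.\<close>
    have "?p (c # cs) x = 0" "?p (c # cs) y = 0"
      using cs by (simp_all add: foldr_minus_scale_eigen[OF T c(2)] T.scale c(2) scale_left_commute)
    then have "?p (c # cs) (scale a x + y) = 0"
      by (simp only: foldr_minus_scale_add[OF T] foldr_minus_scale_scale[OF T]) simp
    with cs c(1) show ?case by (intro exI[of _ "c # cs"]) auto
  qed
  then obtain cs where cs: "t \<notin> set cs" "?p cs v = 0" by blast
  have "(\<Prod>c\<leftarrow>cs. t - c) \<noteq> 0" using cs(1) by (auto simp: prod_list_zero_iff)
  with cs(2) show ?thesis by (simp add: foldr_minus_scale_eigen[OF T v])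
qed

end

section \<open>Ladders of eigenvectors and the Fitting decomposition\<close>

context finite_dimensional_vector_space
begin

text \<open>If no \<open>y k\<close> were zero, they would be eigenvectors for distinct eigenvalues,
  hence arbitrarily many independent vectors.\<close>

lemma ladder_terminates:
  fixes y :: "nat \<Rightarrow> 'b" and ev :: "nat \<Rightarrow> 'a"
  assumes T: "Vector_Spaces.linear scale scale T"
    and ladder: "\<And>k. T (y k) = scale (ev k) (y k)" and inj: "inj ev"
  shows "\<exists>k. y k = 0"
proof (rule ccontr)
  assume nz: "\<nexists>k. y k = 0"
  have notin: "y k \<notin> span (y ` {..<k})" for k
  proof
    assume "y k \<in> span (y ` {..<k})"
    moreover have "y ` {..<k} \<subseteq> {u. \<exists>c. c \<noteq> ev k \<and> T u = scale c u}"
    proof safe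
      fix i assume "i < k"
      then have "ev i \<noteq> ev k" using inj by (auto simp: inj_eq)
      then show "\<exists>c. c \<noteq> ev k \<and> T (y i) = scale c (y i)" using ladder by blast
    qed
    ultimately have "y k \<in> span {u. \<exists>c. c \<noteq> ev k \<and> T u = scale c u}"
      using span_mono by blast
    with eigenvector_in_span_others[OF T ladder] nz show False by blast
  qed
  have indep: "independent (y ` {..<k}) \<and> card (y ` {..<k}) = k" for k
  proof (induction k)
    case (Suc k)
    have "y k \<notin> y ` {..<k}" using notin[of k] span_base by metis
    then show ?case using Suc.IH notin[of k]
      by (simp only: lessThan_Suc image_insert independent_insert if_False card_insert_disjoint
          finite_imageI finite_lessThan simp_thms)
  qed (simp add: independent_empty)
  have "card (y ` {..<Suc dimension}) \<le> dim (y ` {..<Suc dimension})"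
    by (rule independent_card_le_dim[OF order_refl indep[THEN conjunct1]])
  also have "\<dots> \<le> dimension" by (rule dim_subset_UNIV)
  finally show False using indep[of "Suc dimension"] by simp
qed

text \<open>The kernels of the powers increase and have bounded dimension, so they become constant.
  From then on kernel and range meet in zero, so the power is injective on its range and, by
  dimension, maps that range onto itself.\<close>

lemma fitting:
  assumes T: "Vector_Spaces.linear scale scale T"
  obtains k where "0 < k" "{x. (T ^^ k) x = 0} \<inter> range (T ^^ k) = {0}"
    "{u + w | u w. u \<in> {x. (T ^^ k) x = 0} \<and> w \<in> range (T ^^ k)} = UNIV"
proof -
  define K where "K k = {x. (T ^^ k) x = 0}" for k
  interpret P: Vector_Spaces.linear scale scale "T ^^ k" for k by (rule linear_funpow[OF T])
  interpret T: Vector_Spaces.linear scale scale T by (rule T)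
  have sub: "subspace (K k)" for k unfolding K_def by (rule P.subspace_kernel)
  have mono: "K k \<subseteq> K (Suc k)" for k by (auto simp: K_def)
  have "\<exists>k. K (Suc k) = K k"
  proof (rule ccontr)
    assume "\<nexists>k. K (Suc k) = K k"
    then have less: "dim (K k) < dim (K (Suc k))" for k
      using subspace_dim_equal[OF sub sub mono] by (metis not_le)
    have "k \<le> dim (K k)" for k
      by (induction k) (use less le_less_trans in \<open>auto simp: Suc_le_eq\<close>)
    then have "Suc dimension \<le> dim (K (Suc dimension))" .
    also have "\<dots> \<le> dimension" by (rule dim_subset_UNIV)
    finally show False by simp
  qed
  then obtain k where k: "K (Suc k) = K k" by blast
  have stable: "K (k + i) = K k" for i
  proof (induction i)
    case (Suc i)
    have "x \<in> K (Suc k)" if "x \<in> K (k + Suc i)" for x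
    proof -
      have "T x \<in> K (k + i)" using that by (simp add: K_def funpow_swap1)
      then have "T x \<in> K k" by (simp only: Suc.IH)
      then show ?thesis by (simp add: K_def funpow_swap1)
    qed
    then show ?case using k mono Suc.IH by (metis (no_types, opaque_lifting) add_Suc_right subsetI subset_antisym)
  qed simp
  \<comment> \<open>The successor of the stable exponent is still stable, and it is
    positive.\<close>
  define n where "n = Suc k"
  have stable': "K (n + n) = K n" using stable[of 1] stable[of "k + 2"] by (simp add: n_def)
  let ?R = "range (T ^^ n)"
  have R: "subspace ?R" by (rule P.subspace_image) simp
  have inter: "K n \<inter> ?R = {0}"
  proof -
    have "(T ^^ n) y = 0" if "(T ^^ n) y \<in> K n" for y
    proof -
      have "y \<in> K (n + n)" using that by (simp add: K_def funpow_add)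
      then have "y \<in> K n" by (simp only: stable')
      then show ?thesis by (simp add: K_def)
    qed
    then have "K n \<inter> ?R \<subseteq> {0}" by blast
    then show ?thesis using subspace_0[OF R] subspace_0[OF sub] by blast
  qed
  have "inj_on (T ^^ n) ?R"
    unfolding P.inj_on_iff_eq_0[OF R] using inter unfolding K_def by blast
  interpret FP: finite_dimensional_vector_space_pair_1 scale Basis scale
    by unfold_locales
  have "dim ((T ^^ n) ` ?R) = dim ?R"
    by (rule FP.dim_image_eq[OF linear_funpow[OF T]])
       (simp only: span_eq_iff[THEN iffD2, OF R] \<open>inj_on (T ^^ n) ?R\<close>)
  then have surj: "(T ^^ n) ` ?R = ?R"
    by (intro subspace_dim_equal P.subspace_image R) auto
  \<comment> \<open>Some \<open>w\<close> in the range has the same image as \<open>x\<close>, so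
    \<open>x - w\<close> lies in the kernel.\<close>
  have "\<exists>u w. x = u + w \<and> u \<in> K n \<and> w \<in> ?R" for x
  proof -
    obtain w where "w \<in> ?R" "(T ^^ n) x = (T ^^ n) w" using surj by blast
    then show ?thesis
      by (intro exI[of _ "x - w"] exI[of _ w]) (auto simp: K_def P.diff)
  qed
  with inter show thesis by (intro that[of n]) (auto simp: K_def n_def)
qed

end

section \<open>Modules over \<open>gl n\<close>\<close>

text \<open>\<open>e i j\<close> is the action of a matrix unit. The commutator relation is oriented
  so that its instances rewrite products of operators into a chosen order.\<close>

locale gl_module = vector_space scale
  for scale :: "complex \<Rightarrow> 'v::ab_group_add \<Rightarrow> 'v" +
  fixes n :: nat and e :: "nat \<Rightarrow> nat \<Rightarrow> 'v \<Rightarrow> 'v"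
  assumes linear_e: "\<lbrakk>i < n; j < n\<rbrakk> \<Longrightarrow> Vector_Spaces.linear scale scale (e i j)"
    and e_comm: "\<lbrakk>i < n; j < n; k < n; l < n\<rbrakk> \<Longrightarrow> e i j (e k l x) =
      e k l (e i j x) + ((if j = k then e i l x else 0) - (if l = i then e k j x else 0))"
begin

lemma
  assumes "i < n" "j < n"
  shows e_add: "e i j (x + y) = e i j x + e i j y"
    and e_diff: "e i j (x - y) = e i j x - e i j y"
    and e_minus: "e i j (- x) = - e i j x"
    and e_zero: "e i j 0 = 0"
    and e_scale: "e i j (scale c x) = scale c (e i j x)"
    and e_sum: "e i j (sum f A) = (\<Sum>a\<in>A. e i j (f a))"
proof -
  interpret E: Vector_Spaces.linear scale scale "e i j" using assms by (rule linear_e)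
  show "e i j (x + y) = e i j x + e i j y" "e i j (x - y) = e i j x - e i j y"
    "e i j (- x) = - e i j x" "e i j 0 = 0" "e i j (scale c x) = scale c (e i j x)"
    "e i j (sum f A) = (\<Sum>a\<in>A. e i j (f a))"
    by (rule E.add E.diff E.neg E.zero E.scale E.sum)+
qed

lemmas e_linear_simps = e_add e_diff e_minus e_zero e_scale

text \<open>Writing small multiples as sums lets operator identities be settled by cancellation in
  an abelian group.\<close>

lemma double: "scale 2 x = x + x"
  using scale_left_distrib[of 1 1 x] by simp
lemma triple: "scale 3 x = x + x + x"
  using scale_left_distrib[of 2 1 x] by (simp add: double)

lemma e_image_span:
  assumes "i < n" "j < n" "x \<in> span S" "\<And>s. s \<in> S \<Longrightarrow> e i j s \<in> span S'"
  shows "e i j x \<in> span S'"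
  using assms(3)
  by (induction rule: span_induct_alt)
     (use assms in \<open>auto simp: e_linear_simps intro: span_zero span_add span_scale\<close>)

definition invariant :: "'v set \<Rightarrow> bool" where
  "invariant W \<longleftrightarrow> subspace W \<and> (\<forall>i<n. \<forall>j<n. \<forall>x\<in>W. e i j x \<in> W)"

end

section \<open>The modules with highest weight \<open>m \<phi>\<^sub>1\<close>\<close>

text \<open>The model is \<open>v\<close> = x_0^m among the polynomials of degree \<open>m\<close>.
  Condition \<open>e_v\<close> also covers \<open>i = j\<close> and \<open>i > j\<close>, so the
  matrix units on the variables other than x_0 kill \<open>v\<close> as well.\<close>

locale symmetric_power = gl_module scale n e
  for scale :: "complex \<Rightarrow> 'v::ab_group_add \<Rightarrow> 'v" and n :: nat and e :: "nat \<Rightarrow> nat \<Rightarrow> 'v \<Rightarrow> 'v" +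
  fixes v :: 'v and m :: nat
  assumes n_pos: "0 < n" and v_nonzero: "v \<noteq> 0"
    and e_00_v: "e 0 0 v = scale (of_nat m) v"
    and e_v: "\<lbrakk>i < n; 0 < j; j < n\<rbrakk> \<Longrightarrow> e i j v = 0"
    and irreducible: "invariant W \<Longrightarrow> W = {0} \<or> W = UNIV"
begin

text \<open>In the model, for length at most \<open>m\<close>, a nonzero multiple of the monomial
  whose variables other than x_0 are the letters of \<open>w\<close>.\<close>

definition word :: "nat list \<Rightarrow> 'v" where
  "word w = foldr (\<lambda>l. e l 0) w v"

abbreviation valid :: "nat list \<Rightarrow> bool" where
  "valid w \<equiv> set w \<subseteq> {0<..<n}"

text \<open>The index is the length plus one: \<open>words 0\<close> is empty, and
  \<open>raise_word\<close> needs no exception for the empty word.\<close>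

definition words :: "nat \<Rightarrow> 'v set" where
  "words k = {word w | w. valid w \<and> Suc (length w) = k}"

lemma word_Nil [simp]: "word [] = v"
  and word_Cons [simp]: "word (l # w) = e l 0 (word w)"
  by (simp_all add: word_def)

lemma lower_words:
  assumes "0 < l" "l < n" "x \<in> span (words k)"
  shows "e l 0 x \<in> span (words (Suc k))"
proof (rule e_image_span)
  fix s assume "s \<in> words k"
  then obtain w where w: "valid w" "Suc (length w) = k" "s = word w" by (auto simp: words_def)
  then have "e l 0 s = word (l # w)" "valid (l # w)" "Suc (length (l # w)) = Suc k"
    using assms by auto
  then have "e l 0 s \<in> words (Suc k)" unfolding words_def by blast
  then show "e l 0 s \<in> span (words (Suc k))" by (rule span_base)
qed (use assms in auto)

lemma e_00_word: "valid w \<Longrightarrow> e 0 0 (word w) = scale (of_nat m - of_nat (length w)) (word w)"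
proof (induction w)
  case (Cons l w)
  then have "e 0 0 (e l 0 (word w)) = e l 0 (e 0 0 (word w)) - e l 0 (word w)"
    using n_pos by (subst e_comm) auto
  also have "\<dots> = scale (of_nat m - of_nat (length w)) (e l 0 (word w)) - e l 0 (word w)"
    using Cons n_pos by (simp add: e_scale)
  finally show ?case by (simp add: scale_left_diff_distrib scale_left_distrib)
qed (simp add: e_00_v)

text \<open>In the model \<open>e i j\<close> replaces a factor x_j by x_i, which keeps the
  length.\<close>

lemma e_word:
  assumes "0 < i" "i < n" "0 < j" "j < n" "valid w"
  shows "e i j (word w) \<in> span (words (Suc (length w)))"
  using assms(5)
proof (induction w)
  case (Cons l w)
  then have l: "0 < l" "l < n" and w: "valid w" by auto
  have "e i j (e l 0 (word w)) = e l 0 (e i j (word w)) + (if j = l then e i 0 (word w) else 0)"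
    using assms l n_pos by (subst e_comm) auto
  moreover have "e l 0 (e i j (word w)) \<in> span (words (Suc (Suc (length w))))"
    using Cons.IH[OF w] l by (intro lower_words)
  moreover have "e i 0 (word w) \<in> span (words (Suc (Suc (length w))))"
    using w assms by (intro lower_words span_base) (auto simp: words_def)
  ultimately show ?case by (auto intro: span_add)
qed (use assms in \<open>simp add: e_v span_zero\<close>)

lemma raise_word:
  assumes "0 < j" "j < n" "valid w"
  shows "e 0 j (word w) \<in> span (words (length w))"
  using assms(3)
proof (induction w)
  case (Cons l w)
  then have l: "0 < l" "l < n" and w: "valid w" by auto
  have "e 0 j (e l 0 (word w)) = e l 0 (e 0 j (word w)) + ((if j = l then e 0 0 (word w) else 0) - e l j (word w))"
    using assms l n_pos by (subst e_comm) auto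
  moreover have "e l 0 (e 0 j (word w)) \<in> span (words (Suc (length w)))"
    using Cons.IH[OF w] l by (intro lower_words)
  moreover have "e 0 0 (word w) \<in> span (words (Suc (length w)))"
    unfolding e_00_word[OF w] by (rule span_scale, rule span_base) (use w in \<open>auto simp: words_def\<close>)
  moreover have "e l j (word w) \<in> span (words (Suc (length w)))"
    using l w assms by (intro e_word)
  ultimately show ?case by (auto intro!: span_add span_diff span_zero)
qed (use assms in \<open>simp add: e_v n_pos span_zero\<close>)

text \<open>Only the operators \<open>e 0 j\<close> shorten a word, so only they could lead out of
  the span, and \<open>top\<close> stops them at length \<open>k\<close>. Used for
  \<open>k = 0\<close> to get the whole module and for \<open>k = Suc m\<close> to show that long
  words vanish.\<close>

lemma invariant_words:
  assumes top: "\<And>w j. \<lbrakk>valid w; length w = k; 0 < j; j < n\<rbrakk> \<Longrightarrow> e 0 j (word w) = 0"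
  shows "invariant (span (\<Union>i\<in>{Suc k..}. words i))" (is "invariant (span ?W)")
  unfolding invariant_def
proof (intro conjI allI impI ballI subspace_span)
  fix i j x assume ij: "i < n" "j < n" and x: "x \<in> span ?W"
  have sub: "span (words l) \<subseteq> span ?W" if "Suc k \<le> l" for l
    using that by (intro span_mono) auto
  show "e i j x \<in> span ?W"
  proof (rule e_image_span[OF ij x])
    fix s assume "s \<in> ?W"
    then obtain w where w: "valid w" "k \<le> length w" "s = word w" by (auto simp: words_def)
    have "i = 0 \<and> j = 0 \<or> 0 < i \<and> 0 < j \<or> 0 < i \<and> j = 0 \<or> i = 0 \<and> 0 < j \<and> length w = k
      \<or> i = 0 \<and> 0 < j \<and> k < length w" using w by auto
    then show "e i j s \<in> span ?W"
    proof (elim disjE conjE)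
      assume "i = 0" "j = 0"
      moreover have "s \<in> span ?W" using w by (intro span_base) (auto simp: words_def)
      ultimately show ?thesis using w by (simp add: e_00_word span_scale)
    next
      assume "0 < i" "0 < j"
      then show ?thesis using e_word[of i j w] sub[of "Suc (length w)"] w ij by auto
    next
      assume *: "0 < i" "j = 0"
      have "s \<in> span (words (Suc (length w)))" using w by (auto simp: words_def intro!: span_base)
      from lower_words[OF *(1) ij(1) this] show ?thesis using sub[of "Suc (Suc (length w))"] w * by auto
    next
      assume "i = 0" "0 < j" "length w = k"
      then show ?thesis using top[of w j] w ij by (simp add: span_zero)
    next
      assume "i = 0" "0 < j" "k < length w"
      then show ?thesis using raise_word[of j w] sub[of "length w"] w ij by auto
    qed
  qed
qed

lemma span_words: "span (\<Union>i\<in>{Suc 0..}. words i) = UNIV"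
proof -
  have "v \<in> words (Suc 0)" unfolding words_def by (rule CollectI, rule exI[of _ "[]"]) simp
  then have "v \<in> span (\<Union>i\<in>{Suc 0..}. words i)" by (intro span_base) auto
  moreover have "invariant (span (\<Union>i\<in>{Suc 0..}. words i))"
    by (rule invariant_words) (use n_pos in \<open>auto simp: e_v\<close>)
  ultimately show ?thesis using irreducible v_nonzero by blast
qed

text \<open>In the model both sides multiply by x_i x_l and differentiate by x_0 and x_j. The
  commutation relations alone do not give this; the induction starts from
  \<open>e_v\<close>.\<close>

lemma swap_lower_word:
  assumes "0 < i" "i < n" "0 < l" "l < n" "0 < j" "j < n" "valid w"
  shows "e i 0 (e l j (word w)) = e l 0 (e i j (word w))"
  using assms(7)
proof (induction w)
  case (Cons p w)
  then have p: "0 < p" "p < n" and w: "valid w" by auto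
  \<comment> \<open>The first letter is moved out through both operators; the operators
    \<open>e a 0\<close> and \<open>e p 0\<close> commute.\<close>
  have *: "e a 0 (e b j (e p 0 (word w))) =
      e p 0 (e a 0 (e b j (word w))) + (if j = p then e a 0 (e b 0 (word w)) else 0)"
    if "0 < a" "a < n" "0 < b" "b < n" for a b
  proof -
    have "e b j (e p 0 (word w)) = e p 0 (e b j (word w)) + (if j = p then e b 0 (word w) else 0)"
      using that p assms n_pos by (subst e_comm) auto
    moreover have "e a 0 (e p 0 (e b j (word w))) = e p 0 (e a 0 (e b j (word w)))"
      using that p assms n_pos by (subst e_comm) auto
    ultimately show ?thesis using that n_pos by (simp add: e_add e_zero)
  qed
  have "e i 0 (e l 0 (word w)) = e l 0 (e i 0 (word w))"
    using assms n_pos by (subst e_comm) auto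
  then show ?case using Cons.IH[OF w] assms by (simp add: *)
qed (use assms n_pos in \<open>simp add: e_v e_zero\<close>)

text \<open>The scalar is the value of \<open>e 0 0 + 1\<close> on \<open>e i j (word w)\<close>;
  compare moving the derivative by x_0 past the factor x_0.\<close>

lemma lower_raise_word:
  assumes "0 < i" "i < n" "0 < j" "j < n" "valid w"
  shows "e i 0 (e 0 j (word w)) = scale (of_nat m - of_nat (length w) + 1) (e i j (word w))"
  using assms(5)
proof (induction w)
  case (Cons l w)
  then have l: "0 < l" "l < n" and w: "valid w" by auto
  let ?x = "word w" and ?c = "of_nat m - of_nat (length w) :: complex"
  have "e 0 j (e l 0 ?x) = e l 0 (e 0 j ?x) + ((if j = l then e 0 0 ?x else 0) - e l j ?x)"
    using assms l n_pos by (subst e_comm) auto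
  moreover have "e i 0 (e l 0 (e 0 j ?x)) = e l 0 (e i 0 (e 0 j ?x))"
    using assms l n_pos by (subst e_comm) auto
  moreover have "e i 0 (e l j ?x) = e l 0 (e i j ?x)"
    using assms l w by (intro swap_lower_word)
  ultimately have "e i 0 (e 0 j (e l 0 ?x)) =
      scale (?c + 1) (e l 0 (e i j ?x)) + ((if j = l then scale ?c (e i 0 ?x) else 0) - e l 0 (e i j ?x))"
    using assms l w n_pos Cons.IH[OF w] by (simp add: e_add e_diff e_zero e_scale e_00_word)
  also have "\<dots> = scale ?c (e l 0 (e i j ?x) + (if j = l then e i 0 ?x else 0))"
    by (simp add: scale_right_distrib scale_left_distrib)
  also have "e l 0 (e i j ?x) + (if j = l then e i 0 ?x else 0) = e i j (e l 0 ?x)"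
    using assms l n_pos by (subst e_comm) auto
  finally show ?case by simp
qed (use assms n_pos in \<open>simp add: e_v e_zero\<close>)

text \<open>The words longer than \<open>m\<close> span an invariant subspace. It misses
  \<open>v\<close>, whose \<open>e 0 0\<close> eigenvalue \<open>m\<close> does not occur there, so
  it is zero by irreducibility.\<close>

lemma long_word_zero:
  assumes "valid w" "m < length w"
  shows "word w = 0"
proof -
  let ?W = "span (\<Union>i\<in>{Suc (Suc m)..}. words i)"
  have "e 0 j (word u) = 0" if u: "valid u" "length u = Suc m" and j: "0 < j" "j < n" for u j
  proof -
    obtain l w where w: "u = l # w" "length w = m" using u by (cases u) auto
    then have l: "0 < l" "l < n" "valid w" using u by auto
    have "e 0 j (e l 0 (word w)) =
        e l 0 (e 0 j (word w)) + ((if j = l then e 0 0 (word w) else 0) - e l j (word w))"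
      using j l n_pos by (subst e_comm) auto
    \<comment> \<open>At length \<open>m\<close> the factor in \<open>lower_raise_word\<close> is 1
      and \<open>e 0 0\<close> acts as 0, so the two copies of \<open>e l j (word w)\<close>
      cancel.\<close>
    also have "\<dots> = 0" using j l w by (simp add: lower_raise_word e_00_word)
    finally show ?thesis by (simp add: w)
  qed
  then have "invariant ?W" by (intro invariant_words) auto
  moreover have "?W \<noteq> UNIV"
  proof
    assume "?W = UNIV"
    then have "v \<in> ?W" by simp
    moreover have "(\<Union>i\<in>{Suc (Suc m)..}. words i) \<subseteq> {u. \<exists>c. c \<noteq> of_nat m \<and> e 0 0 u = scale c u}"
    proof safe
      fix u i assume "u \<in> words i" "Suc (Suc m) \<le> i"
      then obtain w where w: "valid w" "u = word w" "Suc m \<le> length w" by (auto simp: words_def)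
      then have "of_nat m - of_nat (length w) \<noteq> (of_nat m :: complex)" by auto
      then show "\<exists>c. c \<noteq> of_nat m \<and> e 0 0 u = scale c u" using w e_00_word by blast
    qed
    ultimately have "v \<in> span {u. \<exists>c. c \<noteq> of_nat m \<and> e 0 0 u = scale c u}"
      using span_mono by blast
    then show False using eigenvector_in_span_others[OF linear_e e_00_v] n_pos v_nonzero by blast
  qed
  ultimately have "?W = {0}" using irreducible by blast
  moreover have "word w \<in> ?W" using assms by (intro span_base) (auto simp: words_def)
  ultimately show ?thesis by blast
qed

lemma eq_on_words:
  assumes f: "Vector_Spaces.linear scale scale f" and g: "Vector_Spaces.linear scale scale g"
    and words: "\<And>w. valid w \<Longrightarrow> f (word w) = g (word w)"
  shows "f x = g x"
proof -
  interpret f: Vector_Spaces.linear scale scale f by (rule f)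
  interpret g: Vector_Spaces.linear scale scale g by (rule g)
  have "x \<in> span (\<Union>i\<in>{Suc 0..}. words i)" by (simp add: span_words)
  then show ?thesis
    by (induction rule: span_induct_alt) (auto simp: words words_def f.add g.add f.scale g.scale)
qed

lemma lower_raise:
  assumes "0 < i" "i < n" "0 < j" "j < n"
  shows "e i 0 (e 0 j x) = e 0 0 (e i j x) + e i j x"
proof (rule eq_on_words[where f = "\<lambda>x. e i 0 (e 0 j x)" and g = "\<lambda>x. e 0 0 (e i j x) + e i j x"])
  show "Vector_Spaces.linear scale scale (\<lambda>x. e i 0 (e 0 j x))"
    "Vector_Spaces.linear scale scale (\<lambda>x. e 0 0 (e i j x) + e i j x)"
    using assms n_pos by (auto intro!: linearI simp: e_add e_scale scale_right_distrib algebra_simps)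
  fix w assume w: "valid w"
  have "e 0 0 (e i j (word w)) = e i j (e 0 0 (word w))"
    using assms n_pos by (subst e_comm) auto
  with w show "e i 0 (e 0 j (word w)) = e 0 0 (e i j (word w)) + e i j (word w)"
    using assms by (simp add: lower_raise_word e_00_word e_scale scale_left_distrib)
qed

text \<open>The nonzero words have length at most \<open>m\<close>, so their \<open>e 0 0\<close>
  eigenvalues are nonnegative and -1 is none of them.\<close>

lemma e_00_plus_1_inj:
  assumes "e 0 0 x + x = 0"
  shows "x = 0"
proof (rule eigenvector_in_span_others[OF linear_e])
  show "e 0 0 x = scale (- 1) x" using assms by (simp add: eq_neg_iff_add_eq_0)
  have "(\<Union>i\<in>{Suc 0..}. words i) \<subseteq> {u. \<exists>c. c \<noteq> - 1 \<and> e 0 0 u = scale c u}"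
  proof safe
    fix u i assume "u \<in> words i"
    then obtain w where w: "valid w" "u = word w" by (auto simp: words_def)
    show "\<exists>c. c \<noteq> - 1 \<and> e 0 0 u = scale c u"
    proof (cases "length w \<le> m")
      case True
      have "of_nat m - of_nat (length w) \<noteq> (- 1 :: complex)"
      proof
        assume "of_nat m - of_nat (length w) = (- 1 :: complex)"
        with True have "of_nat (Suc (m - length w)) = (0 :: complex)" by (simp add: of_nat_diff)
        then show False by (simp only: of_nat_neq_0)
      qed
      then show ?thesis using w e_00_word by blast
    next
      case False
      \<comment> \<open>The word is the zero vector, for which any eigenvalue other than -1
        serves.\<close>
      then show ?thesis using w n_pos by (intro exI[of _ 0]) (simp add: long_word_zero e_zero)
    qed
  qed
  then show "x \<in> span {u. \<exists>c. c \<noteq> - 1 \<and> e 0 0 u = scale c u}"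
    using span_words span_mono by blast
qed (use n_pos in auto)

text \<open>In a symmetric power, \<open>e 0 j\<close> is \<open>x\<^sub>0 \<partial>\<^sub>j\<close>, so it kills the same vectors as \<open>\<partial>\<^sub>j\<close>.\<close>

lemma e_eq_0_if_raise_eq_0:
  assumes "e 0 j x = 0" "0 < i" "i < n" "0 < j" "j < n"
  shows "e i j x = 0"
  by (rule e_00_plus_1_inj) (use lower_raise[of i j x] assms n_pos in \<open>simp add: e_zero\<close>)

text \<open>Euler's identity for homogeneous polynomials: the identity matrix is central, and it
  acts on \<open>v\<close> as \<open>m\<close>.\<close>

lemma trace_action: "(\<Sum>i<n. e i i x) = scale (of_nat m) x"
proof (rule eq_on_words[where f = "\<lambda>x. \<Sum>i<n. e i i x" and g = "scale (of_nat m)"])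
  show "Vector_Spaces.linear scale scale (\<lambda>x. \<Sum>i<n. e i i x)"
    by (intro linearI) (simp_all add: e_add e_scale sum.distrib scale_sum_right)
  show "Vector_Spaces.linear scale scale (scale (of_nat m))"
    by (intro linearI) (simp_all add: scale_right_distrib scale_left_commute)
  fix w assume "valid w"
  then show "(\<Sum>i<n. e i i (word w)) = scale (of_nat m) (word w)"
  proof (induction w)
    case Nil
    have "(\<Sum>i<n. e i i v) = (\<Sum>i<n. if i = 0 then e 0 0 v else 0)"
      by (intro sum.cong) (auto simp: e_v)
    then show ?case using n_pos by (simp add: e_00_v)
  next
    case (Cons l w)
    then have l: "0 < l" "l < n" by auto
    have "(\<Sum>i<n. e i i (e l 0 (word w))) = (\<Sum>i<n. e l 0 (e i i (word w)) +
        ((if i = l then e l 0 (word w) else 0) - (if i = 0 then e l 0 (word w) else 0)))"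
      using l n_pos by (intro sum.cong refl, subst e_comm) auto
    also have "\<dots> = e l 0 (\<Sum>i<n. e i i (word w))"
      using l n_pos by (simp add: sum.distrib sum_subtractf e_sum)
    finally show ?case using Cons l n_pos by (simp add: e_scale)
  qed
qed

text \<open>The hypothesis makes every \<open>e j j\<close> with \<open>j > 0\<close> kill
  \<open>x\<close>, so \<open>trace_action\<close> gives \<open>x\<close> the \<open>e 0 0\<close>
  eigenvalue \<open>m\<close>, which only the empty word has.\<close>

lemma singular_multiple:
  assumes "\<And>j. \<lbrakk>0 < j; j < n\<rbrakk> \<Longrightarrow> e 0 j x = 0"
  shows "\<exists>c. x = scale c v"
proof -
  have "(\<Sum>i<n. e i i x) = (\<Sum>i<n. if i = 0 then e 0 0 x else 0)"
    using assms by (intro sum.cong) (auto intro: e_eq_0_if_raise_eq_0)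
  then have x: "e 0 0 x = scale (of_nat m) x" using n_pos by (simp add: trace_action)
  let ?S = "{u. \<exists>c. c \<noteq> of_nat m \<and> e 0 0 u = scale c u}"
  have sub: "u \<in> insert v ?S" if u: "u \<in> words i" for u i
  proof -
    obtain w where w: "valid w" "u = word w" using u by (auto simp: words_def)
    show ?thesis
    proof (cases "w = []")
      case False
      then have "of_nat m - of_nat (length w) \<noteq> (of_nat m :: complex)" by simp
      then show ?thesis using w e_00_word by blast
    qed (use w in simp)
  qed
  then have "span (\<Union>i\<in>{Suc 0..}. words i) \<subseteq> span (insert v ?S)"
    by (intro span_mono) blast
  then have "x \<in> span (insert v ?S)" unfolding span_words by blast
  then obtain c where c: "x - scale c v \<in> span ?S" using span_breakdown_eq by blast
  have "e 0 0 (x - scale c v) = scale (of_nat m) (x - scale c v)"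
    using n_pos by (simp add: e_diff e_scale x e_00_v scale_right_diff_distrib mult.commute)
  from eigenvector_in_span_others[OF linear_e this c] n_pos show ?thesis by auto
qed

end

section \<open>Nilpotent operators and the subalgebra fixing the highest weight line\<close>

lemma ladder_operator_nilpotent:
  fixes scale :: "complex \<Rightarrow> 'v::ab_group_add \<Rightarrow> 'v"
  assumes fd: "finite_dimensional_vector_space scale Basis"
    and T: "Vector_Spaces.linear scale scale T" and z: "Vector_Spaces.linear scale scale z"
    and comm: "\<And>x. T (z x) = z (T x) + scale c (z x)" and c: "c \<noteq> 0"
    and y: "T y = scale t y"
  shows "T ((z ^^ k) y) = scale (t + of_nat k * c) ((z ^^ k) y)" and "\<exists>k. (z ^^ k) y = 0"
proof -
  interpret finite_dimensional_vector_space scale Basis by (rule fd)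
  interpret z: Vector_Spaces.linear scale scale z by (rule z)
  \<comment> \<open>Each application of \<open>z\<close> raises the eigenvalue of \<open>T\<close>
    by \<open>c\<close>.\<close>
  show eigen: "T ((z ^^ k) y) = scale (t + of_nat k * c) ((z ^^ k) y)" for k
    by (induction k) (simp_all add: y comm z.add z.scale scale_left_distrib distrib_right)
  show "\<exists>k. (z ^^ k) y = 0"
    by (rule ladder_terminates[OF T eigen]) (use c in \<open>auto intro: injI\<close>)
qed

context vector_space
begin

lemma locally_nilpotent_span:
  assumes z: "Vector_Spaces.linear scale scale z"
    and S: "\<And>s. s \<in> S \<Longrightarrow> \<exists>k. (z ^^ k) s = 0" and x: "x \<in> span S"
  shows "\<exists>k. (z ^^ k) x = 0"
  using x
proof (induction rule: span_induct_alt)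
  case base
  show ?case by (rule exI[of _ 0]) simp
next
  case (step c s y)
  interpret P: Vector_Spaces.linear scale scale "z ^^ k" for k by (rule linear_funpow[OF z])
  obtain k l where kl: "(z ^^ k) s = 0" "(z ^^ l) y = 0" using S step by blast
  have "(z ^^ (l + k)) s = 0" "(z ^^ (k + l)) y = 0"
    unfolding funpow_add by (simp_all add: kl)
  then have "(z ^^ (k + l)) (scale c s + y) = 0" by (simp add: P.add P.scale add.commute)
  then show ?case by blast
qed

text \<open>The last nonzero iterate of \<open>z\<close> on \<open>x\<close> is the required
  vector.\<close>

lemma nilpotent_kernel:
  assumes nil: "\<exists>k. (z ^^ k) x = 0" and W: "x \<in> W" "x \<noteq> 0" "\<And>y. y \<in> W \<Longrightarrow> z y \<in> W"
  obtains y where "y \<in> W" "y \<noteq> 0" "z y = 0"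
proof -
  define k where "k = (LEAST k. (z ^^ k) x = 0)"
  have k: "(z ^^ k) x = 0" unfolding k_def using nil by (rule LeastI_ex)
  then obtain l where l: "k = Suc l" using W by (cases k) auto
  have "(z ^^ l) x \<noteq> 0" using not_less_Least[of l "\<lambda>k. (z ^^ k) x = 0"] l by (simp add: k_def)
  moreover have "(z ^^ l) x \<in> W" by (induction l) (use W in auto)
  ultimately show thesis using k l that by simp
qed

end

context symmetric_power
begin

text \<open>\<open>T\<close> is the action of diag(3, 2, 1, 0), for which \<open>e i j\<close> has
  degree \<open>j - i\<close>. All words are eigenvectors of \<open>T\<close>, so any
  \<open>z\<close> of nonzero degree is nilpotent on each of them.\<close>

lemma locally_nilpotent:
  assumes fd: "finite_dimensional_vector_space scale Basis" and n: "n = 4"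
    and T: "T = (\<lambda>x. scale 3 (e 0 0 x) + scale 2 (e 1 1 x) + e 2 2 x)"
    and z: "Vector_Spaces.linear scale scale z"
    and comm: "\<And>x. T (z x) = z (T x) + scale c (z x)" and c: "c \<noteq> 0"
  shows "\<exists>k. (z ^^ k) x = 0"
proof (rule locally_nilpotent_span[OF z])
  have lin: "Vector_Spaces.linear scale scale T"
    by (intro linearI) (simp_all add: T n e_add e_scale scale_right_distrib mult.commute add_ac)
  fix s assume "s \<in> (\<Union>i\<in>{Suc 0..}. words i)"
  then obtain w where w: "valid w" "s = word w" by (auto simp: words_def)
  have "\<exists>t. T (word w) = scale t (word w)" using w(1)
  proof (induction w)
    case Nil
    have "T v = scale (3 * of_nat m) v" by (simp add: T n e_v e_00_v)
    then show ?case by auto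
  next
    case (Cons l w)
    then obtain t where t: "T (word w) = scale t (word w)" by auto
    have "l = 1 \<or> l = 2 \<or> l = 3" using Cons.prems n by auto
    then have "T (e l 0 (word w)) = e l 0 (T (word w)) - scale (of_nat l) (e l 0 (word w))"
      by (elim disjE) (simp_all add: T n e_add e_scale scale_right_distrib scale_right_diff_distrib
          e_comm[of 0 0 _ 0] e_comm[of 1 1 _ 0] e_comm[of 2 2 _ 0] double triple del: One_nat_def)
    also have "\<dots> = scale (t - of_nat l) (e l 0 (word w))"
      using Cons.prems n by (simp add: t e_scale scale_left_diff_distrib)
    finally show ?case by auto
  qed
  then obtain t where "T s = scale t s" using w by blast
  then show "\<exists>k. (z ^^ k) s = 0"
    by (rule ladder_operator_nilpotent(2)[OF fd lin z comm c])
qed (simp add: span_words)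

text \<open>The three operators span a subalgebra of \<open>e3\<close> whose elements act nilpotently. A common
  null vector \<open>x\<close> satisfies \<open>\<partial>\<^sub>3 x = 0\<close>, hence \<open>e 1 3 x = 0 = e 0 2 x\<close>, hence
  \<open>\<partial>\<^sub>2 x = 0\<close>, hence \<open>e 2 3 x = 0 = e 0 1 x\<close> and \<open>\<partial>\<^sub>1 x = 0\<close>.\<close>

lemma v_in_submodule:
  assumes fd: "finite_dimensional_vector_space scale Basis" and n: "n = 4"
    and W: "subspace W" "W \<noteq> {0}"
    and W1: "\<And>x. x \<in> W \<Longrightarrow> e 0 3 x \<in> W"
    and W2: "\<And>x. x \<in> W \<Longrightarrow> e 0 2 x - e 1 3 x \<in> W"
    and W3: "\<And>x. x \<in> W \<Longrightarrow> e 0 1 x + e 2 3 x \<in> W"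
  shows "v \<in> W"
proof -
  let ?z1 = "e 0 3" and ?z2 = "\<lambda>x. e 0 2 x - e 1 3 x" and ?z3 = "\<lambda>x. e 0 1 x + e 2 3 x"
  let ?T = "\<lambda>x. scale 3 (e 0 0 x) + scale 2 (e 1 1 x) + e 2 2 x"
  note nil = locally_nilpotent[OF fd n refl]
  \<comment> \<open>The three operators have degrees 3, 2 and 1.\<close>
  have T1: "?T (?z1 x) = ?z1 (?T x) + scale 3 (?z1 x)" for x
    by (simp add: n e_add e_scale double triple e_comm[of 0 0 0 3] e_comm[of 1 1 0 3] e_comm[of 2 2 0 3] del: One_nat_def)
  have T2: "?T (?z2 x) = ?z2 (?T x) + scale 2 (?z2 x)" for x
    by (simp add: n e_add e_diff e_scale double triple algebra_simps e_comm[of 0 0 0 2] e_comm[of 1 1 0 2] e_comm[of 2 2 0 2] e_comm[of 0 0 1 3] e_comm[of 1 1 1 3] e_comm[of 2 2 1 3] del: One_nat_def)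
  have T3: "?T (?z3 x) = ?z3 (?T x) + scale 1 (?z3 x)" for x
    by (simp add: n e_add e_diff e_scale double triple algebra_simps e_comm[of 0 0 0 1] e_comm[of 1 1 0 1] e_comm[of 2 2 0 1] e_comm[of 0 0 2 3] e_comm[of 1 1 2 3] e_comm[of 2 2 2 3] del: One_nat_def)
  obtain x where x: "x \<in> W" "x \<noteq> 0" using W subspace_0 by blast
  have nil1: "\<exists>k. (?z1 ^^ k) x = 0" for x
    by (rule nil[where z = ?z1, OF _ T1]) (auto intro: linear_e simp: n)
  obtain x1 where x1: "x1 \<in> W" "x1 \<noteq> 0" "?z1 x1 = 0"
    using nilpotent_kernel[OF nil1 x W1] by blast
  have lin: "Vector_Spaces.linear scale scale ?z2" "Vector_Spaces.linear scale scale ?z3"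
    by (auto intro!: linearI simp: n e_add e_scale scale_right_distrib scale_right_diff_distrib algebra_simps)
  have nil2: "\<exists>k. (?z2 ^^ k) x = 0" for x
    by (rule nil[where z = ?z2, OF lin(1) T2]) simp
  have z12: "?z1 (?z2 x) = ?z2 (?z1 x)" for x
    by (simp add: n e_diff e_comm[of 0 3 0 2] e_comm[of 0 3 1 3] del: One_nat_def)
  obtain x2 where x2: "x2 \<in> {x\<in>W. ?z1 x = 0}" "x2 \<noteq> 0" "?z2 x2 = 0"
    by (rule nilpotent_kernel[OF nil2, where x = x1 and W = "{x\<in>W. ?z1 x = 0}"])
       (use x1 W2 z12 in \<open>auto simp: e_zero n\<close>)
  have nil3: "\<exists>k. (?z3 ^^ k) x = 0" for x
    by (rule nil[where z = ?z3, OF lin(2) T3]) simp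
  have z13: "?z1 (?z3 x) = ?z3 (?z1 x)" for x
    by (simp add: n e_add e_comm[of 0 3 0 1] e_comm[of 0 3 2 3] del: One_nat_def)
  \<comment> \<open>The commutator is a multiple of \<open>?z1\<close>, so \<open>?z3\<close>
    preserves the common kernel of \<open>?z1\<close> and \<open>?z2\<close>.\<close>
  have z23: "?z2 (?z3 x) = ?z3 (?z2 x) + scale 2 (?z1 x)" for x
    by (simp add: n e_add e_diff double algebra_simps e_comm[of 0 2 0 1] e_comm[of 1 3 0 1] e_comm[of 0 2 2 3] e_comm[of 1 3 2 3] del: One_nat_def)
  have z23': "e 0 2 (?z3 x) = e 1 3 (?z3 x)" if "?z1 x = 0" "?z2 x = 0" for x
  proof -
    have "?z2 (?z3 x) = 0" unfolding z23 that by (simp add: e_zero n)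
    then show ?thesis by simp
  qed
  obtain x3 where x3: "x3 \<in> {x\<in>W. ?z1 x = 0 \<and> ?z2 x = 0}" "x3 \<noteq> 0" "?z3 x3 = 0"
    by (rule nilpotent_kernel[OF nil3, where x = x2 and W = "{x\<in>W. ?z1 x = 0 \<and> ?z2 x = 0}"])
       (use x2 W3 z13 z23' in \<open>auto simp: e_zero n\<close>)
  have "e 0 3 x3 = 0" using x3 by simp
  then have *: "e 1 3 x3 = 0" "e 2 3 x3 = 0" by (auto intro!: e_eq_0_if_raise_eq_0 simp: n)
  then have "e 0 2 x3 = 0" "e 0 1 x3 = 0" using x3 by auto
  with \<open>e 0 3 x3 = 0\<close> have "e 0 j x3 = 0" if "0 < j" "j < n" for j
  proof -
    have "j = 1 \<or> j = 2 \<or> j = 3" using that n by auto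
    then show ?thesis using \<open>e 0 1 x3 = 0\<close> \<open>e 0 2 x3 = 0\<close> \<open>e 0 3 x3 = 0\<close> by blast
  qed
  then obtain c where c: "x3 = scale c v" using singular_multiple by blast
  then have "c \<noteq> 0" using x3 by auto
  then have "v = scale (inverse c) x3" by (simp add: c)
  then show ?thesis using x3 W by (simp add: subspace_scale)
qed

end

section \<open>Extension of the action from \<open>sl n\<close> to \<open>gl n\<close>\<close>

text \<open>The scalar \<open>t\<close> stays free; it is later set to \<open>m\<close> or
  \<open>- m\<close> to normalise the weights.\<close>

locale sl_module = lie_module scale "sl n" \<rho>
  for scale :: "complex \<Rightarrow> 'v::ab_group_add \<Rightarrow> 'v" and n :: nat and \<rho> +
  fixes t :: complex
  assumes n_pos: "0 < n"
begin

definition trace :: "(nat \<times> nat \<Rightarrow> complex) \<Rightarrow> complex" where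
  "trace f = (\<Sum>i<n. f (i, i))"

definition traceless :: "(nat \<times> nat \<Rightarrow> complex) \<Rightarrow> complex mat" where
  "traceless f = mat n n (\<lambda>(a, b). f (a, b) - (if a = b then trace f / of_nat n else 0))"

text \<open>The extension of \<open>\<rho>\<close> to \<open>gl n\<close> (matrices are given by their entries) for which the
  identity matrix acts as the scalar \<open>t\<close>.\<close>

definition gl_act :: "(nat \<times> nat \<Rightarrow> complex) \<Rightarrow> 'v \<Rightarrow> 'v" where
  "gl_act f x = \<rho> (traceless f) x + scale (t * trace f / of_nat n) x"

definition unit :: "nat \<Rightarrow> nat \<Rightarrow> nat \<times> nat \<Rightarrow> complex" where
  "unit i j p = (if p = (i, j) then 1 else 0)"

definition e :: "nat \<Rightarrow> nat \<Rightarrow> 'v \<Rightarrow> 'v" where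
  "e i j = gl_act (unit i j)"

lemma traceless_sl: "traceless f \<in> sl n"
  using n_pos by (simp add: sl_def traceless_def sum_subtractf trace_def)

lemma act_scale: "X \<in> sl n \<Longrightarrow> \<rho> X (scale c x) = scale c (\<rho> X x)"
  and act_add_vec: "X \<in> sl n \<Longrightarrow> \<rho> X (x + y) = \<rho> X x + \<rho> X y"
  using act_linear[of X] unfolding Vector_Spaces.linear_iff_module_hom module_hom_iff by auto

lemma linear_gl_act: "Vector_Spaces.linear scale scale (gl_act f)"
  by (intro linearI)
     (simp_all add: gl_act_def act_scale act_add_vec traceless_sl scale_right_distrib mult.commute add_ac)

lemma gl_act_add: "gl_act (\<lambda>p. f p + g p) x = gl_act f x + gl_act g x"
proof -
  have "traceless (\<lambda>p. f p + g p) = traceless f + traceless g"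
    by (intro eq_matI) (auto simp: traceless_def trace_def sum.distrib add_divide_distrib)
  moreover have "trace (\<lambda>p. f p + g p) = trace f + trace g" by (simp add: trace_def sum.distrib)
  ultimately show ?thesis
    by (simp add: gl_act_def act_add traceless_sl scale_left_distrib distrib_left add_divide_distrib)
qed

lemma gl_act_smult: "gl_act (\<lambda>p. c * f p) x = scale c (gl_act f x)"
proof -
  have "traceless (\<lambda>p. c * f p) = c \<cdot>\<^sub>m traceless f"
    by (intro eq_matI) (auto simp: traceless_def trace_def right_diff_distrib simp flip: sum_distrib_left)
  moreover have "trace (\<lambda>p. c * f p) = c * trace f" by (simp add: trace_def sum_distrib_left)
  ultimately show ?thesis
    by (simp add: gl_act_def act_smult traceless_sl scale_right_distrib mult.left_commute)
qed

lemma gl_act_cong: "(\<And>a b. \<lbrakk>a < n; b < n\<rbrakk> \<Longrightarrow> f (a, b) = g (a, b)) \<Longrightarrow> gl_act f = gl_act g"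
proof -
  assume *: "\<And>a b. \<lbrakk>a < n; b < n\<rbrakk> \<Longrightarrow> f (a, b) = g (a, b)"
  then have "trace f = trace g" by (simp add: trace_def)
  moreover from this have "traceless f = traceless g"
    using * by (intro eq_matI) (auto simp: traceless_def)
  ultimately show ?thesis by (simp add: gl_act_def fun_eq_iff)
qed

lemma gl_act_sl:
  assumes "X \<in> sl n"
  shows "gl_act (\<lambda>p. X $$ p) x = \<rho> X x"
proof -
  have "trace (\<lambda>p. X $$ p) = 0" using assms by (simp add: trace_def sl_def)
  moreover from this have "traceless (\<lambda>p. X $$ p) = X"
    using assms by (intro eq_matI) (auto simp: traceless_def sl_def)
  ultimately show ?thesis by (simp add: gl_act_def)
qed

lemma gl_act_zero: "gl_act (\<lambda>p. 0) x = 0"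
  using gl_act_smult[of 0 "\<lambda>p. 0" x] by simp

lemma gl_act_expand: "gl_act f x = (\<Sum>i<n. \<Sum>j<n. scale (f (i, j)) (e i j x))"
proof -
  have "gl_act (\<lambda>p. if p \<in> A then f p else 0) x = (\<Sum>p\<in>A. scale (f p) (e (fst p) (snd p) x))"
    if "finite A" for A
    using that
  proof (induction A)
    case (insert q A)
    have "(\<lambda>p. if p \<in> insert q A then f p else 0) =
        (\<lambda>p. f q * unit (fst q) (snd q) p + (if p \<in> A then f p else 0))"
      using insert by (auto simp: unit_def)
    then show ?case using insert by (simp add: gl_act_add gl_act_smult e_def)
  qed (simp add: gl_act_zero)
  from this[of "{..<n} \<times> {..<n}"] show ?thesis
    by (simp add: sum.cartesian_product case_prod_beta
        gl_act_cong[of f "\<lambda>p. if p \<in> {..<n} \<times> {..<n} then f p else 0"])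
qed

lemma act_expand: "X \<in> sl n \<Longrightarrow> \<rho> X x = (\<Sum>i<n. \<Sum>j<n. scale (X $$ (i, j)) (e i j x))"
  using gl_act_expand gl_act_sl by metis

text \<open>Scalar parts drop out of a commutator, and a commutator of matrices has trace zero, so
  the relation for \<open>\<rho>\<close> carries over.\<close>

lemma gl_act_commutator:
  "gl_act f (gl_act g x) - gl_act g (gl_act f x) =
    gl_act (\<lambda>(a, b). \<Sum>c<n. f (a, c) * g (c, b) - g (a, c) * f (c, b)) x"
    (is "_ = gl_act ?h x")
proof -
  have "trace ?h = (\<Sum>a<n. \<Sum>c<n. f (a, c) * g (c, a)) - (\<Sum>a<n. \<Sum>c<n. g (a, c) * f (c, a))"
    by (simp add: trace_def sum_subtractf)
  also have "(\<Sum>a<n. \<Sum>c<n. g (a, c) * f (c, a)) = (\<Sum>a<n. \<Sum>c<n. f (a, c) * g (c, a))"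
    by (subst sum.swap) (simp add: mult.commute)
  finally have tr: "trace ?h = 0" by simp
  have "traceless ?h = lie_bracket (traceless f) (traceless g)"
  proof (rule eq_matI)
    fix a b assume "a < dim_row (lie_bracket (traceless f) (traceless g))"
      "b < dim_col (lie_bracket (traceless f) (traceless g))"
    then have ab: "a < n" "b < n" by (auto simp: lie_bracket_def traceless_def)
    let ?\<alpha> = "trace f / of_nat n" and ?\<beta> = "trace g / of_nat n"
    have "lie_bracket (traceless f) (traceless g) $$ (a, b) =
      (\<Sum>c<n. (f (a, c) - (if a = c then ?\<alpha> else 0)) * (g (c, b) - (if c = b then ?\<beta> else 0))) -
      (\<Sum>c<n. (g (a, c) - (if a = c then ?\<beta> else 0)) * (f (c, b) - (if c = b then ?\<alpha> else 0)))"
      using ab by (simp add: lie_bracket_def traceless_def scalar_prod_def atLeast0LessThan)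
    \<comment> \<open>The terms with \<open>?\<alpha>\<close> and \<open>?\<beta>\<close> survive
      only at \<open>c = a\<close> and \<open>c = b\<close>, with opposite sums.\<close>
    also have "\<dots> = (\<Sum>c<n. (f (a, c) * g (c, b) - g (a, c) * f (c, b)) +
        (if c = a then ?\<beta> * f (a, b) - ?\<alpha> * g (a, b) else 0) +
        (if c = b then ?\<alpha> * g (a, b) - ?\<beta> * f (a, b) else 0))"
      unfolding sum_subtractf[symmetric] by (intro sum.cong) (auto simp: algebra_simps)
    also have "\<dots> = (\<Sum>c<n. f (a, c) * g (c, b) - g (a, c) * f (c, b))"
      using ab by (simp add: sum.distrib)
    finally show "traceless ?h $$ (a, b) = lie_bracket (traceless f) (traceless g) $$ (a, b)"
      using ab tr by (simp add: traceless_def)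
  qed (auto simp: lie_bracket_def traceless_def)
  then have "gl_act ?h x = \<rho> (traceless f) (\<rho> (traceless g) x) - \<rho> (traceless g) (\<rho> (traceless f) x)"
    by (simp add: gl_act_def tr act_bracket traceless_sl)
  then show ?thesis
    by (simp add: gl_act_def act_scale act_add_vec traceless_sl scale_right_distrib algebra_simps)
qed

sublocale gl_module scale n e
proof (intro gl_module.intro gl_module_axioms.intro)
  show "vector_space scale" by unfold_locales
next
  show "Vector_Spaces.linear scale scale (e i j)" for i j unfolding e_def by (rule linear_gl_act)
next
  fix i j k l x assume ij: "i < n" "j < n" "k < n" "l < n"
  let ?d = "\<lambda>P. if P then 1 else 0 :: complex"
  have "(\<lambda>(a, b). \<Sum>c<n. unit i j (a, c) * unit k l (c, b) - unit k l (a, c) * unit i j (c, b)) =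
    (\<lambda>p. ?d (j = k) * unit i l p + - ?d (l = i) * unit k j p)"
  proof (intro ext, clarify)
    fix a b
    have "(\<Sum>c<n. unit i j (a, c) * unit k l (c, b) - unit k l (a, c) * unit i j (c, b)) =
      (\<Sum>c<n. (if c = j then ?d (j = k) * unit i l (a, b) else 0) -
        (if c = l then ?d (l = i) * unit k j (a, b) else 0))"
      by (intro sum.cong) (auto simp: unit_def)
    also have "\<dots> = ?d (j = k) * unit i l (a, b) - ?d (l = i) * unit k j (a, b)"
      using ij by (simp add: sum_subtractf)
    finally show "(\<Sum>c<n. unit i j (a, c) * unit k l (c, b) - unit k l (a, c) * unit i j (c, b)) =
      ?d (j = k) * unit i l (a, b) + - ?d (l = i) * unit k j (a, b)" by simp
  qed
  then have "e i j (e k l x) - e k l (e i j x) =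
      scale (?d (j = k)) (e i l x) + scale (- ?d (l = i)) (e k j x)"
    unfolding e_def gl_act_commutator by (simp only: gl_act_add gl_act_smult)
  then show "e i j (e k l x) = e k l (e i j x) + ((if j = k then e i l x else 0) - (if l = i then e k j x else 0))"
    by (auto simp: algebra_simps)
qed

text \<open>The extension to gl adds only scalar operators, which preserve every subspace.\<close>

lemma lie_submodule_iff_invariant: "lie_submodule scale (sl n) \<rho> W \<longleftrightarrow> invariant W"
proof
  assume "invariant W"
  then show "lie_submodule scale (sl n) \<rho> W"
    by (auto simp: lie_submodule_def invariant_def act_expand intro!: subspace_sum subspace_scale)
next
  assume W: "lie_submodule scale (sl n) \<rho> W"
  then have "subspace W" by (simp add: lie_submodule_def)
  moreover have "e i j x \<in> W" if "x \<in> W" for i j x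
    using that W traceless_sl unfolding e_def gl_act_def lie_submodule_def
    by (auto intro!: subspace_add subspace_scale)
  ultimately show "invariant W" by (simp add: invariant_def)
qed

end

section \<open>The Casimir operator of \<open>sp 4\<close>\<close>

context gl_module
begin

text \<open>Together with \<open>e 0 3\<close>, \<open>e 3 0\<close>, \<open>e 1 2\<close> and \<open>e 2 1\<close>, these form a basis of \<open>sp 4\<close>.\<close>

definition "h1 x = e 0 0 x - e 3 3 x"
definition "h2 x = e 1 1 x - e 2 2 x"
definition "xp x = e 0 1 x + e 2 3 x"
definition "xm x = e 1 0 x + e 3 2 x"
definition "yp x = e 0 2 x - e 1 3 x"
definition "ym x = e 2 0 x - e 3 1 x"

lemmas sp_defs = h1_def h2_def xp_def xm_def yp_def ym_def

text \<open>Twice the Casimir element of the trace form. The long root vectors \<open>e 0 3\<close>,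
  \<open>e 1 2\<close> and their opposites pair to 1 instead of 2, whence the factor 2.\<close>

definition casimir :: "'v \<Rightarrow> 'v" where
  "casimir x = h1 (h1 x) + h2 (h2 x) + (xp (xm x) + xm (xp x)) + (yp (ym x) + ym (yp x)) +
     scale 2 (e 0 3 (e 3 0 x) + e 3 0 (e 0 3 x)) + scale 2 (e 1 2 (e 2 1 x) + e 2 1 (e 1 2 x))"

context
  assumes n: "n = 4"
begin

lemma sp_linear:
  "h1 (x + y) = h1 x + h1 y" "h2 (x + y) = h2 x + h2 y" "xp (x + y) = xp x + xp y"
  "xm (x + y) = xm x + xm y" "yp (x + y) = yp x + yp y" "ym (x + y) = ym x + ym y"
  "h1 (x - y) = h1 x - h1 y" "h2 (x - y) = h2 x - h2 y" "xp (x - y) = xp x - xp y"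
  "xm (x - y) = xm x - xm y" "yp (x - y) = yp x - yp y" "ym (x - y) = ym x - ym y"
  "h1 (scale c x) = scale c (h1 x)" "h2 (scale c x) = scale c (h2 x)" "xp (scale c x) = scale c (xp x)"
  "xm (scale c x) = scale c (xm x)" "yp (scale c x) = scale c (yp x)" "ym (scale c x) = scale c (ym x)"
  by (simp_all add: sp_defs n e_add e_diff e_scale scale_right_distrib scale_right_diff_distrib)

lemma linear_casimir: "Vector_Spaces.linear scale scale casimir"
  by (intro linearI)
     (simp_all add: casimir_def sp_linear n e_add e_scale scale_right_distrib mult.commute add_ac)

text \<open>These rules move \<open>xp\<close> to the left through every other operator in
  \<open>casimir\<close>.\<close>

lemma xp_comm:
  "h1 (xp x) = xp (h1 x) + xp x" "h2 (xp x) = xp (h2 x) - xp x"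
  "xm (xp x) = xp (xm x) - h1 x + h2 x"
  "yp (xp x) = xp (yp x) + scale 2 (e 0 3 x)" "ym (xp x) = xp (ym x) + scale 2 (e 2 1 x)"
  "e 0 3 (xp x) = xp (e 0 3 x)" "e 3 0 (xp x) = xp (e 3 0 x) - ym x"
  "e 1 2 (xp x) = xp (e 1 2 x) - yp x" "e 2 1 (xp x) = xp (e 2 1 x)"
  by (simp_all add: sp_defs n double e_add e_diff e_comm[of _ _ 0 1] e_comm[of _ _ 2 3] del: One_nat_def)

lemma xm_comm:
  "h1 (xm x) = xm (h1 x) - xm x" "h2 (xm x) = xm (h2 x) + xm x"
  "xp (xm x) = xm (xp x) + h1 x - h2 x"
  "yp (xm x) = xm (yp x) - scale 2 (e 1 2 x)" "ym (xm x) = xm (ym x) - scale 2 (e 3 0 x)"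
  "e 0 3 (xm x) = xm (e 0 3 x) + yp x" "e 3 0 (xm x) = xm (e 3 0 x)"
  "e 1 2 (xm x) = xm (e 1 2 x)" "e 2 1 (xm x) = xm (e 2 1 x) + ym x"
  by (simp_all add: sp_defs n double e_add e_diff e_comm[of _ _ 1 0] e_comm[of _ _ 3 2] del: One_nat_def)

lemma zp_comm:
  "h1 (e 0 3 x) = e 0 3 (h1 x) + scale 2 (e 0 3 x)" "h2 (e 0 3 x) = e 0 3 (h2 x)"
  "xp (e 0 3 x) = e 0 3 (xp x)" "xm (e 0 3 x) = e 0 3 (xm x) - yp x"
  "yp (e 0 3 x) = e 0 3 (yp x)" "ym (e 0 3 x) = e 0 3 (ym x) + xp x"
  "e 3 0 (e 0 3 x) = e 0 3 (e 3 0 x) - h1 x"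
  "e 1 2 (e 0 3 x) = e 0 3 (e 1 2 x)" "e 2 1 (e 0 3 x) = e 0 3 (e 2 1 x)"
  by (simp_all add: sp_defs n double e_add e_diff e_comm[of _ _ 0 3] del: One_nat_def)

text \<open>Only \<open>xp\<close>, \<open>xm\<close> and \<open>e 0 3\<close> need a computation;
  the other basis elements of \<open>e3\<close> are, up to a factor, iterated commutators of
  these.\<close>

lemma casimir_xp: "casimir (xp x) = xp (casimir x)"
  by (simp add: casimir_def double sp_linear n e_linear_simps xp_comm del: One_nat_def)

lemma casimir_xm: "casimir (xm x) = xm (casimir x)"
  by (simp add: casimir_def double sp_linear n e_linear_simps xm_comm del: One_nat_def)

lemma casimir_zp: "casimir (e 0 3 x) = e 0 3 (casimir x)"
  by (simp add: casimir_def double sp_linear n e_linear_simps zp_comm del: One_nat_def)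

lemma casimir_simps:
  "casimir (x + y) = casimir x + casimir y" "casimir (x - y) = casimir x - casimir y"
  "casimir (scale c x) = scale c (casimir x)"
proof -
  interpret C: Vector_Spaces.linear scale scale casimir by (rule linear_casimir)
  show "casimir (x + y) = casimir x + casimir y" "casimir (x - y) = casimir x - casimir y"
    "casimir (scale c x) = scale c (casimir x)"
    by (rule C.add C.diff C.scale)+
qed

lemma casimir_cartan: "casimir (h1 x - h2 x) = h1 (casimir x) - h2 (casimir x)"
proof -
  have "h1 x - h2 x = xp (xm x) - xm (xp x)" for x using xm_comm(3)[of x] by simp
  then show ?thesis by (simp add: casimir_simps casimir_xp casimir_xm)
qed

lemma casimir_yp: "casimir (yp x) = yp (casimir x)"
proof -
  have "yp x = e 0 3 (xm x) - xm (e 0 3 x)" for x using xm_comm(6)[of x] by simp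
  then show ?thesis by (simp add: casimir_simps casimir_zp casimir_xm)
qed

lemma casimir_wp: "casimir (e 1 2 x) = e 1 2 (casimir x)"
proof -
  have "scale 2 (e 1 2 x) = xm (yp x) - yp (xm x)" for x using xm_comm(4)[of x] by simp
  then have "scale 2 (casimir (e 1 2 x)) = scale 2 (e 1 2 (casimir x))"
    by (metis casimir_simps(2,3) casimir_xm casimir_yp)
  then show ?thesis by simp
qed

text \<open>The usual value (\<lambda>, \<lambda> + 2 \<rho>) for \<lambda> = (p, q) and half sum of
  positive roots (2, 1). The vectors \<open>yp w\<close> and \<open>e 0 3 w\<close> vanish since
  these operators come from commutators of \<open>xp\<close> and \<open>e 1 2\<close>.\<close>

lemma casimir_singular:
  assumes "h1 w = scale p w" "h2 w = scale q w" "xp w = 0" "e 1 2 w = 0"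
  shows "casimir w = scale (p\<^sup>2 + q\<^sup>2 + 4 * p + 2 * q) w"
proof -
  have zero: "xp 0 = 0" "xm 0 = 0" "yp 0 = 0" "ym 0 = 0" by (simp_all add: sp_defs n e_zero)
  have yp: "yp w = 0" using xp_comm(8)[of w] assms by (simp add: zero e_zero n)
  have zp: "e 0 3 w = 0" using xp_comm(4)[of w] assms yp by (simp add: zero)
  have "xp (xm w) = scale (p - q) w" using xm_comm(3)[of w] assms
    by (simp add: zero scale_left_diff_distrib)
  moreover have "yp (ym w) = ym (yp w) + h1 w + h2 w"
    by (simp add: sp_defs n e_add e_diff e_comm[of 0 2] e_comm[of 1 3] del: One_nat_def)
  then have "yp (ym w) = scale (p + q) w" using yp assms by (simp add: zero scale_left_distrib)
  moreover have "e 0 3 (e 3 0 w) = scale p w"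
    using e_comm[of 0 3 3 0 w] zp assms by (simp add: n e_zero h1_def)
  moreover have "e 1 2 (e 2 1 w) = scale q w"
    using e_comm[of 1 2 2 1 w] assms by (simp add: n e_zero h2_def)
  ultimately have "casimir w = scale (p * p) w + scale (q * q) w + scale (p - q) w + scale (p + q) w +
      scale (2 * p) w + scale (2 * q) w"
    by (simp add: casimir_def zero e_zero n yp zp assms sp_linear del: One_nat_def)
  also have "\<dots> = scale (p * p + q * q + (p - q) + (p + q) + 2 * p + 2 * q) w"
    by (simp only: scale_left_distrib)
  also have "p * p + q * q + (p - q) + (p + q) + 2 * p + 2 * q = p\<^sup>2 + q\<^sup>2 + 4 * p + 2 * q"
    by (simp add: power2_eq_square)
  finally show ?thesis .
qed

text \<open>The second singular vector exists by the branching rule from \<open>so 6\<close> to \<open>so 5\<close>: the restriction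
  of the irreducible module with highest weight \<open>a \<phi>\<^sub>1 + b \<phi>\<^sub>2 + c \<phi>\<^sub>3\<close> is
  reducible unless \<open>b = 0\<close> and \<open>a c = 0\<close>.\<close>

lemma casimir_two_eigenvalues:
  fixes a b c :: nat
  assumes v: "v \<noteq> 0" "\<And>i j. \<lbrakk>i < j; j < 4\<rbrakk> \<Longrightarrow> e i j v = 0"
    and diag: "\<And>i. i < 4 \<Longrightarrow> e i i v = scale (l i) v"
    and abc: "l 0 - l 1 = of_nat a" "l 1 - l 2 = of_nat b" "l 2 - l 3 = of_nat c"
    and nontrivial: "b \<noteq> 0 \<or> a \<noteq> 0 \<and> c \<noteq> 0"
  obtains s t w where "casimir v = scale s v" "casimir w = scale t w" "w \<noteq> 0" "s \<noteq> t"
proof -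
  \<comment> \<open>The eigenvalues of \<open>h1\<close> and \<open>h2\<close> on
    \<open>v\<close>.\<close>
  define p q :: complex where "p = of_nat (a + b + c)" and "q = of_nat b"
  have l: "l 2 = l 3 + of_nat c" "l 1 = l 3 + of_nat c + of_nat b"
    "l 0 = l 3 + of_nat c + of_nat b + of_nat a"
    using abc by (auto simp: algebra_simps)
  have raise: "e 0 1 v = 0" "e 0 2 v = 0" "e 0 3 v = 0" "e 1 2 v = 0" "e 1 3 v = 0" "e 2 3 v = 0"
    using v(2) by auto
  have d: "e 0 0 v = scale (l 0) v" "e 1 1 v = scale (l 1) v" "e 2 2 v = scale (l 2) v"
    "e 3 3 v = scale (l 3) v"
    using diag by auto
  have hv: "h1 v = scale p v" "h2 v = scale q v"
    by (simp_all add: h1_def h2_def d p_def q_def l scale_left_distrib del: One_nat_def)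
  have Cv: "casimir v = scale (p\<^sup>2 + q\<^sup>2 + 4 * p + 2 * q) v"
    by (rule casimir_singular[OF hv]) (simp_all add: raise xp_def del: One_nat_def)
  have h_low: "h1 (e 1 0 x) = e 1 0 (h1 x) - e 1 0 x" "h2 (e 1 0 x) = e 1 0 (h2 x) + e 1 0 x"
    "h1 (e 3 2 x) = e 3 2 (h1 x) - e 3 2 x" "h2 (e 3 2 x) = e 3 2 (h2 x) + e 3 2 x"
    "h1 (e 2 1 x) = e 2 1 (h1 x)" "h2 (e 2 1 x) = e 2 1 (h2 x) - scale 2 (e 2 1 x)" for x
    by (simp_all add: h1_def h2_def n e_diff double e_comm[of 0 0] e_comm[of 1 1] e_comm[of 2 2]
        e_comm[of 3 3] del: One_nat_def)
  note scale_distribs = scale_left_distrib scale_left_diff_distrib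
  note push = n e_add e_diff e_minus e_zero e_scale raise d e_comm[of 0 1] e_comm[of 2 3] e_comm[of 1 2]
    e_comm[of 0 0] e_comm[of 1 1] e_comm[of 2 2] e_comm[of 3 3]
  let ?A = "e 1 0 v" and ?B = "e 3 2 v" and ?D = "e 2 1 v"
  have raise_AB: "e 0 1 ?A = scale (of_nat a) v" "e 2 3 ?A = 0" "e 1 2 ?A = 0"
    "e 0 1 ?B = 0" "e 2 3 ?B = scale (of_nat c) v" "e 1 2 ?B = 0"
    "e 0 1 ?D = 0" "e 2 3 ?D = 0" "e 1 2 ?D = scale (of_nat b) v"
    by (simp_all add: push l scale_distribs del: One_nat_def)
  show thesis
  proof (cases "b = 0")
    case False
    let ?X = "e 1 0 ?D" and ?Y = "e 2 1 ?A" and ?Z = "e 3 2 ?D" and ?U = "e 2 1 ?B"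
    define s t :: complex where "s = of_nat (b + c + 1)" and "t = - of_nat (a + b + 1)"
    \<comment> \<open>The weights \<open>b + 1\<close> and \<open>b\<close> make
      \<open>e 1 2\<close> kill the \<open>?X\<close>, \<open>?Y\<close> part and the
      \<open>?Z\<close>, \<open>?U\<close> part separately; \<open>s\<close> and \<open>t\<close>
      then balance \<open>e 0 1 w\<close> against \<open>e 2 3 w\<close>, so that
      \<open>xp w = 0\<close>.\<close>
    define w where "w = scale (- s * of_nat (b + 1)) ?X + scale (s * of_nat b) ?Y +
      scale (- t * of_nat (b + 1)) ?Z + scale (t * of_nat b) ?U"
    have raise_w: "e 0 1 ?X = scale (of_nat (a + 1)) ?D" "e 2 3 ?X = 0" "e 1 2 ?X = scale (of_nat b) ?A"
      "e 0 1 ?Y = scale (of_nat a) ?D" "e 2 3 ?Y = 0" "e 1 2 ?Y = scale (of_nat (b + 1)) ?A"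
      "e 0 1 ?Z = 0" "e 2 3 ?Z = scale (of_nat (c + 1)) ?D" "e 1 2 ?Z = scale (of_nat b) ?B"
      "e 0 1 ?U = 0" "e 2 3 ?U = scale (of_nat c) ?D" "e 1 2 ?U = scale (of_nat (b + 1)) ?B"
      by (simp_all add: push raise_AB l scale_distribs del: One_nat_def)
    have e01: "e 0 1 w = scale (- s * of_nat (a + b + 1)) ?D"
      by (simp add: w_def n e_add e_diff e_scale raise_w del: One_nat_def flip: scale_left_distrib)
         (simp add: algebra_simps)
    have e23: "e 2 3 w = scale (- t * of_nat (b + c + 1)) ?D"
      by (simp add: w_def n e_add e_diff e_scale raise_w del: One_nat_def flip: scale_left_distrib)
         (simp add: algebra_simps)
    have "xp w = 0"
      unfolding xp_def e01 e23 scale_left_distrib[symmetric] by (simp add: s_def t_def algebra_simps)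
    moreover have "e 1 2 w = 0"
      by (simp add: w_def n e_add e_diff e_scale raise_w mult.assoc mult.commute mult.left_commute del: One_nat_def of_nat_add)
    moreover have
      "h1 ?X = scale (p - 1) ?X" "h1 ?Y = scale (p - 1) ?Y" "h1 ?Z = scale (p - 1) ?Z" "h1 ?U = scale (p - 1) ?U"
      "h2 ?X = scale (q - 1) ?X" "h2 ?Y = scale (q - 1) ?Y" "h2 ?Z = scale (q - 1) ?Z" "h2 ?U = scale (q - 1) ?U"
      by (simp_all add: h_low hv e_add e_diff e_scale n scale_distribs double del: One_nat_def)
    then have "h1 w = scale (p - 1) w" "h2 w = scale (q - 1) w"
      by (simp_all add: w_def sp_linear scale_right_distrib scale_right_diff_distrib mult.commute
          del: One_nat_def of_nat_add)
    ultimately have Cw: "casimir w = scale ((p - 1)\<^sup>2 + (q - 1)\<^sup>2 + 4 * (p - 1) + 2 * (q - 1)) w"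
      by (intro casimir_singular)
    have "?D \<noteq> 0" using raise_AB(9) False v(1) by (auto simp: e_zero n)
    moreover have "s \<noteq> 0" "of_nat (a + b + 1) \<noteq> (0 :: complex)"
      unfolding s_def by (simp_all only: of_nat_eq_0_iff)
    ultimately have "e 0 1 w \<noteq> 0" unfolding e01 by simp
    then have "w \<noteq> 0" by (auto simp: e_zero n)
    moreover have "p\<^sup>2 + q\<^sup>2 + 4 * p + 2 * q \<noteq> (p - 1)\<^sup>2 + (q - 1)\<^sup>2 + 4 * (p - 1) + 2 * (q - 1)"
    proof
      assume "p\<^sup>2 + q\<^sup>2 + 4 * p + 2 * q = (p - 1)\<^sup>2 + (q - 1)\<^sup>2 + 4 * (p - 1) + 2 * (q - 1)"
      then have "2 * (p + q + 2) = 0" by (simp add: power2_eq_square algebra_simps)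
      then have "p + q + 2 = 0" unfolding mult_eq_0_iff by simp
      then have "of_nat (a + b + c + b + 2) = (0 :: complex)" by (simp add: p_def q_def ac_simps)
      then show False by (simp only: of_nat_eq_0_iff)
    qed
    ultimately show thesis by (intro that[OF Cv Cw])
  next
    case True
    \<comment> \<open>\<open>xp\<close> maps \<open>?A\<close> to \<open>a v\<close> and
      \<open>?B\<close> to \<open>c v\<close>, so this combination is singular.\<close>
    define w where "w = scale (of_nat c) ?A - scale (of_nat a) ?B"
    have "xp w = 0"
      by (simp add: w_def xp_def n e_diff e_scale raise_AB mult.commute del: One_nat_def)
    moreover have "e 1 2 w = 0"
      by (simp add: w_def n e_diff e_scale raise_AB del: One_nat_def)
    moreover have "h1 ?A = scale (p - 1) ?A" "h1 ?B = scale (p - 1) ?B"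
      "h2 ?A = scale (q + 1) ?A" "h2 ?B = scale (q + 1) ?B"
      by (simp_all add: h_low hv e_scale n scale_distribs del: One_nat_def)
    then have "h1 w = scale (p - 1) w" "h2 w = scale (q + 1) w"
      by (simp_all add: w_def sp_linear scale_right_diff_distrib mult.commute del: One_nat_def)
    ultimately have Cw: "casimir w = scale ((p - 1)\<^sup>2 + (q + 1)\<^sup>2 + 4 * (p - 1) + 2 * (q + 1)) w"
      by (intro casimir_singular)
    have "e 0 1 w = scale (of_nat c * of_nat a) v"
      by (simp add: w_def n e_diff e_scale raise_AB del: One_nat_def)
    then have "e 0 1 w \<noteq> 0" using True nontrivial v(1) by simp
    then have "w \<noteq> 0" by (auto simp: e_zero n)
    moreover have "p\<^sup>2 + q\<^sup>2 + 4 * p + 2 * q \<noteq> (p - 1)\<^sup>2 + (q + 1)\<^sup>2 + 4 * (p - 1) + 2 * (q + 1)"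
    proof
      assume "p\<^sup>2 + q\<^sup>2 + 4 * p + 2 * q = (p - 1)\<^sup>2 + (q + 1)\<^sup>2 + 4 * (p - 1) + 2 * (q + 1)"
      then have "2 * (p - q) = 0" by (simp add: power2_eq_square algebra_simps)
      then have "p - q = 0" unfolding mult_eq_0_iff by simp
      then have "of_nat (a + c) = (0 :: complex)" by (simp add: p_def q_def)
      then show False using True nontrivial by (simp only: of_nat_eq_0_iff) simp
    qed
    ultimately show thesis by (intro that[OF Cv Cw])
  qed
qed

end

end

section \<open>Splitting a space by an operator with two eigenvalues\<close>

context finite_dimensional_vector_space
begin

text \<open>The Fitting decomposition of \<open>T - s\<close>: its null part contains
  \<open>v\<close> but not \<open>w\<close>, and every operator commuting with \<open>T\<close>
  preserves both parts.\<close>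

lemma commutant_decomposition:
  assumes T: "Vector_Spaces.linear scale scale T"
    and v: "T v = scale s v" "v \<noteq> 0" and w: "T w = scale t w" "w \<noteq> 0" and st: "s \<noteq> t"
  obtains U W where "subspace U" "subspace W" "U \<noteq> UNIV" "W \<noteq> UNIV" "U \<inter> W = {0}"
    "{u + w | u w. u \<in> U \<and> w \<in> W} = UNIV"
    "\<And>z. \<lbrakk>Vector_Spaces.linear scale scale z; \<And>x. T (z x) = z (T x)\<rbrakk> \<Longrightarrow> z ` U \<subseteq> U \<and> z ` W \<subseteq> W"
proof -
  define P where "P = (\<lambda>x. T x - scale s x)"
  have P: "Vector_Spaces.linear scale scale P" unfolding P_def by (rule linear_minus_scale[OF T])
  obtain k where k: "0 < k" "{x. (P ^^ k) x = 0} \<inter> range (P ^^ k) = {0}"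
    "{u + w | u w. u \<in> {x. (P ^^ k) x = 0} \<and> w \<in> range (P ^^ k)} = UNIV"
    using fitting[OF P] by blast
  interpret Pk: Vector_Spaces.linear scale scale "P ^^ i" for i by (rule linear_funpow[OF P])
  interpret P: Vector_Spaces.linear scale scale P by (rule P)
  let ?U = "{x. (P ^^ k) x = 0}" and ?W = "range (P ^^ k)"
  have "P v = 0" by (simp add: P_def v)
  \<comment> \<open>Here \<open>0 < k\<close> matters: the zeroth power has zero kernel.\<close>
  then have "v \<in> ?U" using k(1) by (cases k) (simp_all add: funpow_swap1 Pk.zero del: funpow.simps add: funpow_Suc_right)
  then have "?W \<noteq> UNIV" using k(2) v(2) by blast
  have "P w = scale (t - s) w" by (simp add: P_def w scale_left_diff_distrib)
  then have "(P ^^ i) w = scale ((t - s) ^ i) w" for i by (induction i) (simp_all add: P.scale mult.commute)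
  then have "w \<notin> ?U" using w(2) st by simp
  then have "?U \<noteq> UNIV" by blast
  have comm: "z ` ?U \<subseteq> ?U \<and> z ` ?W \<subseteq> ?W"
    if z: "Vector_Spaces.linear scale scale z" "\<And>x. T (z x) = z (T x)" for z
  proof -
    interpret z: Vector_Spaces.linear scale scale z by (rule z(1))
    have "(P ^^ i) (z x) = z ((P ^^ i) x)" for i x
      by (induction i) (simp_all add: P_def z.diff z.scale z(2))
    then show ?thesis by (auto simp: z.zero) (metis rangeI)
  qed
  show thesis
    by (rule that[OF Pk.subspace_kernel Pk.subspace_image[OF subspace_UNIV] \<open>?U \<noteq> UNIV\<close> \<open>?W \<noteq> UNIV\<close> k(2,3) comm])
qed

end

section \<open>Restriction to \<open>e3\<close>\<close>

text \<open>At the first vanishing power \<open>Suc k\<close> of the lowering operator, raising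
  gives the factor \<open>Suc k * (a - b - k)\<close> on a nonzero vector, so this factor is
  zero.\<close>

lemma (in gl_module) sl2_singular_vector:
  assumes fd: "finite_dimensional_vector_space scale Basis"
    and ij: "i < n" "j < n" "i \<noteq> j" and v: "v \<noteq> 0" "e i j v = 0"
    and diag: "e i i v = scale a v" "e j j v = scale b v"
  shows "\<exists>k. a - b = of_nat k \<and> (e j i ^^ Suc k) v = 0"
proof -
  define T where "T x = e i i x - e j j x" for x
  let ?z = "e j i"
  have lin: "Vector_Spaces.linear scale scale T" "Vector_Spaces.linear scale scale ?z"
    using ij by (auto intro!: linearI simp: T_def e_linear_simps scale_right_diff_distrib)
  have comm: "T (?z x) = ?z (T x) + scale (- 2) (?z x)" for x
    using ij scale_left_distrib[of 1 1 "?z x"]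
    by (simp add: T_def e_diff e_comm[of i i j i] e_comm[of j j j i])
  have Tv: "T v = scale (a - b) v" by (simp add: T_def diag scale_left_diff_distrib)
  note ladder = ladder_operator_nilpotent[OF fd lin comm _ Tv, simplified]
  define K where "K = (LEAST k. (?z ^^ k) v = 0)"
  have K: "(?z ^^ K) v = 0" unfolding K_def using ladder(2) by (rule LeastI_ex)
  then obtain k where k: "K = Suc k" using v by (cases K) auto
  have nz: "(?z ^^ k) v \<noteq> 0" using not_less_Least[of k "\<lambda>k. (?z ^^ k) v = 0"] k by (simp add: K_def)
  have raise: "e i j (?z x) = ?z (e i j x) + T x" for x
    using ij by (subst e_comm) (auto simp: T_def)
  have "e i j ((?z ^^ Suc l) v) = scale (of_nat (Suc l) * (a - b - of_nat l)) ((?z ^^ l) v)" for l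
  proof (induction l)
    case 0
    show ?case using ij by (simp add: raise v Tv e_zero)
  next
    case (Suc l)
    have "e i j ((?z ^^ Suc (Suc l)) v) = ?z (e i j ((?z ^^ Suc l) v)) + T ((?z ^^ Suc l) v)"
      by (simp add: raise)
    also have "\<dots> = scale (of_nat (Suc l) * (a - b - of_nat l)) ((?z ^^ Suc l) v) +
        scale (a - b + of_nat (Suc l) * - 2) ((?z ^^ Suc l) v)"
      unfolding Suc.IH using ij ladder(1)[of "Suc l"] by (simp add: e_scale)
    also have "\<dots> = scale (of_nat (Suc (Suc l)) * (a - b - of_nat (Suc l))) ((?z ^^ Suc l) v)"
      unfolding scale_left_distrib[symmetric] by (simp add: algebra_simps)
    finally show ?case .
  qed
  from this[of k] K k nz ij have "of_nat (Suc k) * (a - b - of_nat k) = 0" by (simp add: e_zero)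
  then have "a - b = of_nat k" by (simp only: mult_eq_0_iff of_nat_neq_0) simp
  with K k show ?thesis by blast
qed

text \<open>The automorphism that fixes \<open>sp 4\<close>, written on matrix units. The leading
  minus sign makes up for the order reversal by the transpose.\<close>

lemma (in gl_module) antitranspose_twist:
  assumes n: "n = 4"
  shows "gl_module scale 4 (\<lambda>i j x. scale (- ((- 1) ^ (i + j))) (e (3 - j) (3 - i) x))"
proof (intro gl_module.intro gl_module_axioms.intro)
  show "vector_space scale" by unfold_locales
next
  fix i j :: nat assume "i < 4" "j < 4"
  then show "Vector_Spaces.linear scale scale (\<lambda>x. scale (- ((- 1) ^ (i + j))) (e (3 - j) (3 - i) x))"
    by (intro linearI) (simp_all add: n e_add e_scale scale_right_distrib mult.commute)
next
  fix i j k l :: nat and x assume ij: "i < 4" "j < 4" "k < 4" "l < 4"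
  define S :: "nat \<Rightarrow> nat \<Rightarrow> complex" where "S i j = - ((- 1) ^ (i + j))" for i j
  have eq: "3 - i = 3 - l \<longleftrightarrow> l = i" "3 - k = 3 - j \<longleftrightarrow> j = k" using ij by auto
  have sign: "S i k * S k l = - S i l" for i k l
  proof -
    have "(- 1) ^ k * (- 1) ^ k = (1 :: complex)" by (simp flip: power_mult_distrib)
    then show ?thesis by (simp add: S_def power_add algebra_simps)
  qed
  let ?x = "e (3 - j) (3 - i) x" and ?e = "e (3 - l) (3 - k)"
  let ?y = "e (3 - j) (3 - k) x" and ?z = "e (3 - l) (3 - i) x"
  have "e (3 - j) (3 - i) (?e x) = ?e ?x + ((if l = i then ?y else 0) - (if j = k then ?z else 0))"
    using ij by (subst e_comm) (simp_all add: n eq)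
  then have "scale (S i j) (e (3 - j) (3 - i) (scale (S k l) (?e x))) =
    scale (S i j * S k l) (?e ?x + ((if l = i then ?y else 0) - (if j = k then ?z else 0)))"
    using ij by (simp add: e_scale n)
  also have "\<dots> = scale (S k l) (?e (scale (S i j) ?x)) +
    ((if l = i then scale (S i j * S k i) ?y else 0) - (if j = k then scale (S i k * S k l) ?z else 0))"
    using ij by (simp add: e_scale n scale_right_distrib scale_right_diff_distrib mult.commute)
  also have "S i j * S k i = - S k j" using sign[of k i j] by (simp add: mult.commute)
  also have "S i k * S k l = - S i l" by (rule sign)
  also have "(if l = i then scale (- S k j) ?y else 0) - (if j = k then scale (- S i l) ?z else 0) =
    (if j = k then scale (S i l) ?z else 0) - (if l = i then scale (S k j) ?y else 0)"
    by simp
  finally show "scale (- ((- 1) ^ (i + j))) (e (3 - j) (3 - i) (scale (- ((- 1) ^ (k + l))) (?e x))) =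
    scale (- ((- 1) ^ (k + l))) (?e (scale (- ((- 1) ^ (i + j))) ?x)) +
     ((if j = k then scale (- ((- 1) ^ (i + l))) ?z else 0) -
      (if l = i then scale (- ((- 1) ^ (k + j))) ?y else 0))"
    unfolding S_def .
qed

context sl_module
begin

lemma e3_act:
  assumes n: "n = 4" and AB: "A \<in> sl 2" "B \<in> sl 2"
  shows "\<rho> (four_block_mat A B (0\<^sub>m 2 2) A) x =
    scale (A $$ (0, 0)) (h1 x - h2 x) + scale (A $$ (0, 1)) (xp x) + scale (A $$ (1, 0)) (xm x) +
    scale (B $$ (0, 0)) (yp x) + scale (B $$ (0, 1)) (e 0 3 x) + scale (B $$ (1, 0)) (e 1 2 x)"
proof -
  let ?X = "four_block_mat A B (0\<^sub>m 2 2) A"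
  have "?X \<in> e3" using AB by (auto simp: e3_def)
  then have "\<rho> ?X x = (\<Sum>i<4. \<Sum>j<4. scale (?X $$ (i, j)) (e i j x))"
    using act_expand e3_subset_sl n by auto
  also have "\<dots> = scale (A $$ (0, 0)) (h1 x - h2 x) + scale (A $$ (0, 1)) (xp x) + scale (A $$ (1, 0)) (xm x) +
    scale (B $$ (0, 0)) (yp x) + scale (B $$ (0, 1)) (e 0 3 x) + scale (B $$ (1, 0)) (e 1 2 x)"
  proof -
    have "dim_row A = 2" "dim_col A = 2" "dim_row B = 2" "dim_col B = 2"
      using AB by (auto simp: sl_def)
    moreover have "A $$ (1, 1) = - A $$ (0, 0)" "B $$ (1, 1) = - B $$ (0, 0)"
      using AB by (auto simp: sl_2_trace eq_neg_iff_add_eq_0 add.commute)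
    ultimately show ?thesis
      by (simp add: eval_nat_numeral sp_defs scale_right_distrib scale_right_diff_distrib)
  qed
  finally show ?thesis .
qed

lemma e3_submodule_iff:
  assumes n: "n = 4"
  shows "lie_submodule scale e3 \<rho> W \<longleftrightarrow> subspace W \<and> (\<forall>x\<in>W. h1 x - h2 x \<in> W \<and> xp x \<in> W \<and>
    xm x \<in> W \<and> yp x \<in> W \<and> e 0 3 x \<in> W \<and> e 1 2 x \<in> W)"
proof
  assume W: "lie_submodule scale e3 \<rho> W"
  \<comment> \<open>\<open>E 0 1\<close>, \<open>E 1 0\<close> and \<open>H\<close> form a basis of
    \<open>sl 2\<close>; each is used once as the diagonal block and once as the upper right
    block.\<close>
  define E :: "nat \<Rightarrow> nat \<Rightarrow> complex mat" where "E i j = mat 2 2 (\<lambda>p. if p = (i, j) then 1 else 0)" for i j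
  define H :: "complex mat" where "H = mat 2 2 (\<lambda>(i, j). if i = j then (- 1) ^ i else 0)"
  have sl: "E 0 1 \<in> sl 2" "E 1 0 \<in> sl 2" "H \<in> sl 2" "0\<^sub>m 2 2 \<in> sl 2"
    by (auto simp: sl_2_trace E_def H_def)
  have "\<rho> (four_block_mat A B (0\<^sub>m 2 2) A) x \<in> W" if "A \<in> sl 2" "B \<in> sl 2" "x \<in> W" for A B x
    using W that by (auto simp: lie_submodule_def e3_def)
  from this[OF sl(3,4)] this[OF sl(1,4)] this[OF sl(2,4)] this[OF sl(4,3)] this[OF sl(4,1)] this[OF sl(4,2)]
  show "subspace W \<and> (\<forall>x\<in>W. h1 x - h2 x \<in> W \<and> xp x \<in> W \<and>
    xm x \<in> W \<and> yp x \<in> W \<and> e 0 3 x \<in> W \<and> e 1 2 x \<in> W)"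
    using W by (simp add: e3_act[OF n] sl lie_submodule_def del: One_nat_def) (simp add: E_def H_def)
next
  assume "subspace W \<and> (\<forall>x\<in>W. h1 x - h2 x \<in> W \<and> xp x \<in> W \<and>
    xm x \<in> W \<and> yp x \<in> W \<and> e 0 3 x \<in> W \<and> e 1 2 x \<in> W)"
  then show "lie_submodule scale e3 \<rho> W"
    unfolding lie_submodule_def e3_def
    by (auto simp del: One_nat_def simp: e3_act[OF n] intro!: subspace_add subspace_scale)
qed

end

section \<open>Highest weights and the two directions of the equivalence\<close>

locale sl4_highest_weight = sl_module scale 4 \<rho> t
  for scale :: "complex \<Rightarrow> 'v::ab_group_add \<Rightarrow> 'v" and \<rho> t +
  fixes Basis :: "'v set" and v :: 'v and \<mu> :: "complex mat \<Rightarrow> complex"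
  assumes fd: "finite_dimensional_vector_space scale Basis"
    and v_nonzero: "v \<noteq> 0"
    and cartan_v: "H \<in> cartan 4 \<Longrightarrow> \<rho> H v = scale (\<mu> H) v"
    and upper_v: "N \<in> strictly_upper 4 \<Longrightarrow> \<rho> N v = 0"
    and simple: "lie_submodule scale (sl 4) \<rho> W \<Longrightarrow> W = {0} \<or> W = UNIV"
begin

definition weight :: "nat \<Rightarrow> complex" where
  "weight i = \<mu> (traceless (unit i i)) + t / 4"

lemma trace_unit: "trace (unit i j) = (if i = j \<and> i < 4 then 1 else 0)"
proof -
  have "trace (unit i j) = (\<Sum>k<4. if k = i then (if i = j then 1 else 0) else 0)"
    unfolding trace_def by (intro sum.cong refl) (auto simp: unit_def)
  then show ?thesis by simp
qed

lemma traceless_unit_cartan: "traceless (unit i i) \<in> cartan 4"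
  using traceless_sl[of "unit i i"] by (auto simp: cartan_def diagonal_mat_def traceless_def unit_def)

lemma e_diag_v: "i < 4 \<Longrightarrow> e i i v = scale (weight i) v"
  by (simp add: e_def gl_act_def cartan_v traceless_unit_cartan weight_def trace_unit scale_left_distrib)

lemma e_upper_v: "i < j \<Longrightarrow> j < 4 \<Longrightarrow> e i j v = 0"
proof -
  assume ij: "i < j" "j < 4"
  then have "traceless (unit i j) \<in> strictly_upper 4"
    by (auto simp: strictly_upper_def traceless_def trace_unit unit_def)
  with ij show ?thesis by (simp add: e_def gl_act_def upper_v trace_unit)
qed

text \<open>\<open>\<mu>\<close> is an arbitrary function; its linearity on the Cartan subalgebra
  comes from the action on the nonzero vector \<open>v\<close>.\<close>

lemma \<mu>_expand:
  assumes H: "H \<in> cartan 4"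
  shows "\<mu> H = (\<Sum>i<4. H $$ (i, i) * weight i)"
proof -
  have "scale (\<mu> H) v = (\<Sum>i<4. \<Sum>j<4. scale (H $$ (i, j)) (e i j v))"
    using H act_expand cartan_v[OF H] by (auto simp: cartan_def)
  also have "\<dots> = (\<Sum>i<4. \<Sum>j<4. if j = i then scale (H $$ (i, i)) (e i i v) else 0)"
    using H by (intro sum.cong refl) (auto simp: cartan_def sl_def diagonal_mat_def)
  also have "\<dots> = scale (\<Sum>i<4. H $$ (i, i) * weight i) v"
    by (simp add: e_diag_v scale_sum_left)
  finally show ?thesis using v_nonzero by simp
qed

lemma weight_diff:
  assumes "i < j" "j < 4"
  shows "\<exists>k. weight i - weight j = of_nat k \<and> (e j i ^^ Suc k) v = 0"
  by (rule sl2_singular_vector[OF fd _ _ _ v_nonzero])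
     (use assms in \<open>simp_all add: e_upper_v e_diag_v\<close>)

text \<open>Equal weights force \<open>k = 0\<close> in \<open>weight_diff\<close>, so the first
  power already kills \<open>v\<close>.\<close>

lemma e_lower_v:
  assumes "i < j" "j < 4" "weight i = weight j"
  shows "e j i v = 0"
  using weight_diff[OF assms(1,2)] assms(3) by auto

lemma highest_weight_if_indecomposable:
  assumes "indecomposable scale e3 \<rho>"
  shows "\<exists>m::nat. (\<forall>H\<in>cartan 4. \<mu> H = of_nat m * fund_weight 1 H) \<or>
              (\<forall>H\<in>cartan 4. \<mu> H = of_nat m * fund_weight 3 H)"
proof -
  interpret finite_dimensional_vector_space scale Basis by (rule fd)
  obtain a b c where abc: "weight 0 - weight 1 = of_nat a" "weight 1 - weight 2 = of_nat b"
    "weight 2 - weight 3 = of_nat c"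
    using weight_diff[of 0 1] weight_diff[of 1 2] weight_diff[of 2 3] by auto
  have "\<not> (b \<noteq> 0 \<or> a \<noteq> 0 \<and> c \<noteq> 0)"
  proof
    assume "b \<noteq> 0 \<or> a \<noteq> 0 \<and> c \<noteq> 0"
    then obtain s u w where sw: "casimir v = scale s v" "casimir w = scale u w" "w \<noteq> 0" "s \<noteq> u"
      using casimir_two_eigenvalues[OF refl v_nonzero e_upper_v e_diag_v abc] by blast
    obtain U W where UW: "subspace U" "subspace W" "U \<noteq> UNIV" "W \<noteq> UNIV" "U \<inter> W = {0}"
      "{u + w | u w. u \<in> U \<and> w \<in> W} = UNIV"
      and comm: "\<And>z. \<lbrakk>Vector_Spaces.linear scale scale z; \<And>x. casimir (z x) = z (casimir x)\<rbrakk> \<Longrightarrow>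
        z ` U \<subseteq> U \<and> z ` W \<subseteq> W"
      using commutant_decomposition[OF linear_casimir[OF refl] sw(1) v_nonzero sw(2,3,4)] by blast
    have lin: "Vector_Spaces.linear scale scale (\<lambda>x. h1 x - h2 x)" "Vector_Spaces.linear scale scale xp"
      "Vector_Spaces.linear scale scale xm" "Vector_Spaces.linear scale scale yp"
      by (auto intro!: linearI simp: sp_linear scale_right_diff_distrib)
    note comm' = comm[OF lin(1) casimir_cartan[OF refl]] comm[OF lin(2) casimir_xp[OF refl]]
      comm[OF lin(3) casimir_xm[OF refl]] comm[OF lin(4) casimir_yp[OF refl]]
      comm[OF linear_e casimir_zp[OF refl], simplified] comm[OF linear_e casimir_wp[OF refl], simplified]
    have "lie_submodule scale e3 \<rho> U" "lie_submodule scale e3 \<rho> W"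
      unfolding e3_submodule_iff[OF refl] using UW(1,2) comm' by (auto simp: image_subset_iff)
    with UW(3-6) assms show False unfolding indecomposable_def by blast
  qed
  then have "b = 0" "a = 0 \<or> c = 0" by auto
  \<comment> \<open>As the trace is zero, only the differences of the weights matter.\<close>
  have expand: "\<mu> H = H $$ (0, 0) * weight 0 + H $$ (1, 1) * weight 1 + H $$ (2, 2) * weight 2 + H $$ (3, 3) * weight 3"
    "H $$ (3, 3) = - (H $$ (0, 0) + H $$ (1, 1) + H $$ (2, 2))" if "H \<in> cartan 4" for H
    using \<mu>_expand[OF that] that
    by (auto simp: cartan_def sl_def eval_nat_numeral eq_neg_iff_add_eq_0 algebra_simps)
  have fund_weight_3: "fund_weight 3 H = H $$ (0, 0) + H $$ (1, 1) + H $$ (2, 2)" for H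
    by (simp add: fund_weight_def eval_nat_numeral)
  from \<open>a = 0 \<or> c = 0\<close> show ?thesis
  proof
    assume "c = 0"
    then have "weight 3 = weight 2" "weight 1 = weight 2" "weight 0 = weight 2 + of_nat a"
      using abc \<open>b = 0\<close> by (auto simp: algebra_simps)
    then have "\<forall>H\<in>cartan 4. \<mu> H = of_nat a * fund_weight 1 H"
      by (simp add: expand fund_weight_def algebra_simps)
    then show ?thesis by blast
  next
    assume "a = 0"
    then have "weight 2 = weight 3 + of_nat c" "weight 1 = weight 3 + of_nat c" "weight 0 = weight 3 + of_nat c"
      using abc \<open>b = 0\<close> by (auto simp: algebra_simps)
    then have "\<forall>H\<in>cartan 4. \<mu> H = of_nat c * fund_weight 3 H"
      by (simp add: expand fund_weight_3 algebra_simps)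
    then show ?thesis by blast
  qed
qed

text \<open>Two nonzero summands would share \<open>v\<close>, and a zero summand would make the
  other one everything.\<close>

lemma indecomposableI:
  assumes "\<And>W. \<lbrakk>lie_submodule scale e3 \<rho> W; W \<noteq> {0}\<rbrakk> \<Longrightarrow> v \<in> W"
  shows "indecomposable scale e3 \<rho>"
  unfolding indecomposable_def
proof clarify
  fix U W assume UW: "lie_submodule scale e3 \<rho> U" "lie_submodule scale e3 \<rho> W" "U \<noteq> UNIV" "W \<noteq> UNIV"
    "U \<inter> W = {0}" "{u + w | u w. u \<in> U \<and> w \<in> W} = UNIV"
  have "U \<noteq> {0}" "W \<noteq> {0}" using UW(3,4,6) by auto
  then have "v \<in> U \<inter> W" using assms UW(1,2) by blast
  then show False using UW(5) v_nonzero by simp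
qed

lemma weight_fund_weight:
  assumes "\<forall>H\<in>cartan 4. \<mu> H = of_nat m * fund_weight k H" "i < 4" "k \<le> 4"
  shows "weight i = of_nat m * ((if i < k then 1 else 0) - of_nat k / 4) + t / 4"
proof -
  have "fund_weight k (traceless (unit i i)) = (\<Sum>j<k. (if j = i then 1 else 0) - 1 / 4)"
    unfolding fund_weight_def using assms(2,3)
    by (intro sum.cong refl) (auto simp: traceless_def trace_unit unit_def)
  also have "\<dots> = (if i < k then 1 else 0) - of_nat k / 4"
    by (simp add: sum_subtractf)
  finally show ?thesis using assms(1) traceless_unit_cartan by (simp add: weight_def)
qed

text \<open>The choice of \<open>t\<close> turns the weights into (m, 0, 0, 0);
  \<open>e_lower_v\<close> applies to the three equal ones, as \<open>symmetric_power\<close>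
  demands.\<close>

lemma indecomposable_fund_weight_1:
  assumes m: "\<forall>H\<in>cartan 4. \<mu> H = of_nat m * fund_weight 1 H" and t: "t = of_nat m"
  shows "indecomposable scale e3 \<rho>"
proof -
  have weight: "weight i = (if i = 0 then of_nat m else 0)" if "i < 4" for i
    using weight_fund_weight[OF m that] by (auto simp: t field_simps)
  interpret symmetric_power scale 4 e v m
  proof
    show "e 0 0 v = scale (of_nat m) v" by (simp add: e_diag_v weight)
    show "e i j v = 0" if "i < 4" "0 < j" "j < 4" for i j
    proof (cases i j rule: linorder_cases)
      case greater
      then show ?thesis using that by (intro e_lower_v) (auto simp: weight)
    qed (use that in \<open>auto simp: e_upper_v e_diag_v weight\<close>)
    show "W = {0} \<or> W = UNIV" if "invariant W" for W
      using simple that lie_submodule_iff_invariant by blast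
  qed (use v_nonzero in auto)
  show ?thesis
  proof (rule indecomposableI)
    fix W assume "lie_submodule scale e3 \<rho> W" "W \<noteq> {0}"
    then show "v \<in> W"
      unfolding e3_submodule_iff[OF refl] xp_def yp_def by (intro v_in_submodule[OF fd refl]) auto
  qed
qed

text \<open>The twist fixes \<open>e3\<close> pointwise and turns \<open>m \<phi>\<^sub>3\<close> into \<open>m \<phi>\<^sub>1\<close>.\<close>

lemma indecomposable_fund_weight_3:
  assumes m: "\<forall>H\<in>cartan 4. \<mu> H = of_nat m * fund_weight 3 H" and t: "t = - of_nat m"
  shows "indecomposable scale e3 \<rho>"
proof -
  \<comment> \<open>The weights (0, 0, 0, -m) become (m, 0, 0, 0) under the twist.\<close>
  have weight: "weight i = (if i = 3 then - of_nat m else 0)" if "i < 4" for i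
  proof -
    have "weight i = of_nat m * ((if i < 3 then 1 else 0) - 3 / 4) - of_nat m / 4"
      using weight_fund_weight[OF m that] by (simp add: t)
    also have "\<dots> = of_nat m * ((if i < 3 then 1 else 0) - 1)"
      by (simp add: right_diff_distrib)
    finally show ?thesis using that by auto
  qed
  let ?e = "\<lambda>i j x. scale (- ((- 1) ^ (i + j))) (e (3 - j) (3 - i) x)"
  interpret T: gl_module scale 4 ?e by (rule antitranspose_twist) simp
  interpret T: symmetric_power scale 4 ?e v m
  proof
    show "?e 0 0 v = scale (of_nat m) v" by (simp add: e_diag_v weight)
    show "?e i j v = 0" if "i < 4" "0 < j" "j < 4" for i j
    proof -
      have *: "3 - j < 3" "3 - i < 4" using that by auto
      have "e (3 - j) (3 - i) v = 0"
      proof (cases "3 - j" "3 - i" rule: linorder_cases)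
        case greater
        then show ?thesis using * by (intro e_lower_v) (auto simp: weight)
      next
        case equal
        then show ?thesis using * e_diag_v[of "3 - j"] by (simp add: weight)
      qed (use * in \<open>auto simp: e_upper_v\<close>)
      then show ?thesis by simp
    qed
    show "W = {0} \<or> W = UNIV" if W: "T.invariant W" for W
    proof -
      have sub: "subspace W" and closed: "\<And>i j x. i < 4 \<Longrightarrow> j < 4 \<Longrightarrow> x \<in> W \<Longrightarrow> ?e i j x \<in> W"
        using W unfolding T.invariant_def by blast+
      have "e i j x \<in> W" if ij: "i < 4" "j < 4" "x \<in> W" for i j x
      proof -
        \<comment> \<open>The twist is an involution: this vector is \<open>e i j x\<close> up to a
          sign, which the next line removes.\<close>
        have "?e (3 - j) (3 - i) x \<in> W" using ij by (intro closed) auto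
        then have "scale (- ((- 1) ^ (3 - j + (3 - i)))) (?e (3 - j) (3 - i) x) \<in> W"
          by (rule subspace_scale[OF sub])
        then show ?thesis using ij by (simp flip: power_mult_distrib)
      qed
      then have "invariant W" using sub by (simp add: invariant_def)
      then show ?thesis using simple lie_submodule_iff_invariant by blast
    qed
  qed (use v_nonzero in auto)
  show ?thesis
  proof (rule indecomposableI)
    fix W assume "lie_submodule scale e3 \<rho> W" "W \<noteq> {0}"
    \<comment> \<open>The twist exchanges \<open>e 0 1\<close> with \<open>e 2 3\<close> and
      \<open>e 0 2\<close> with \<open>- e 1 3\<close>, and fixes \<open>e 0 3\<close>, so the three
      operators of \<open>v_in_submodule\<close> are unchanged.\<close>
    then show "v \<in> W"
      unfolding e3_submodule_iff[OF refl] xp_def yp_def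
      by (intro T.v_in_submodule[OF fd refl]) (auto simp: eval_nat_numeral add.commute)
  qed
qed

end

theorem theorem5p7:
  fixes scale :: "complex \<Rightarrow> 'v::ab_group_add \<Rightarrow> 'v"
    and \<rho> :: "complex mat \<Rightarrow> 'v \<Rightarrow> 'v"
    and \<mu> :: "complex mat \<Rightarrow> complex"
  assumes "lie_module scale (sl 4) \<rho>"
    and "\<exists>Basis. finite_dimensional_vector_space scale Basis"
    and "simple_module scale (sl 4) \<rho>"
    and "has_highest_weight scale 4 \<rho> \<mu>"
  shows "indecomposable scale e3 \<rho> \<longleftrightarrow>
    (\<exists>m::nat. (\<forall>H\<in>cartan 4. \<mu> H = of_nat m * fund_weight 1 H) \<or>
              (\<forall>H\<in>cartan 4. \<mu> H = of_nat m * fund_weight 3 H))"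
proof -
  obtain Basis where fd: "finite_dimensional_vector_space scale Basis" using assms(2) by blast
  obtain v where v: "v \<noteq> 0" "\<forall>H\<in>cartan 4. \<rho> H v = scale (\<mu> H) v" "\<forall>N\<in>strictly_upper 4. \<rho> N v = 0"
    using assms(4) unfolding has_highest_weight_def by blast
  \<comment> \<open>Keeping \<open>t\<close> general allows the values \<open>m\<close> and
    \<open>- m\<close> in the two converse cases.\<close>
  interpret M: sl4_highest_weight scale \<rho> t Basis v \<mu> for t
    using assms(1,3) fd v
    by (intro sl4_highest_weight.intro sl_module.intro sl_module_axioms.intro sl4_highest_weight_axioms.intro)
       (auto simp: simple_module_def)
  show ?thesis using M.highest_weight_if_indecomposable M.indecomposable_fund_weight_1 M.indecomposable_fund_weight_3 by blast
qed

end
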